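(* Let $(N,J,g)$ be a Ricci-flat Kähler–Einstein manifold of complex dimension $4$, and let $F:M\to N$ be an immersed $4$-dimensional submanifold with equal Kähler angles $\theta$. Let $O$ be an open set of $M$ without $J$-Lagrangian points on which $M$ is $I$-Kähler. Then on $O$, for all tangent vectors $X,Y$, $$\mathrm{Ricci}^M(IX,Y)=-\frac12\,d\big(d\log\cos^2\theta\circ I\big)(X,Y),\qquad s^M=\Delta\log\cos^2\theta .$$
   Context: $M$ carries the induced metric $g$. $\omega(X,Y)=g(JX,Y)$; $(F^*\omega)^\sharp$ is the endomorphism of $TM$ with $g((F^*\omega)^\sharp X,Y)=F^*\omega(X,Y)$. Equal Kähler angles means that all eigenvalues of $(F^*\omega)^\sharp$ at each point are $\pm i\cos\theta$, $\theta\in[0,\pi/2]$. $J$-Lagrangian points are those with $\cos\theta=0$; away from them $(F^*\omega)^\sharp=\cos\theta\,J_\omega$ with $J_\omega$ a $g$-orthogonal almost complex structure. "$M$ is $I$-Kähler on $O$" means that there is on $O$ a Kähler complex structure $I$ for the induced metric ($I$ is $g$-orthogonal and parallel) which anti-commutes with $J_\omega$. $s^M$ is the scalar curvature of $M$, $\Delta$ is the Laplacian $\mathrm{div}\,\mathrm{grad}$ on functions, and $(d\log\cos^2\theta\circ I)(X)=d\log\cos^2\theta(IX)$. *)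

theory Defs
  imports "HOL-Analysis.Analysis"
begin

section \<open>Smooth maps and manifolds\<close>

text \<open>The domain \<open>S\<close> is always an open set in what follows.\<close>

primrec Ck_on :: "nat \<Rightarrow> 'a::euclidean_space set \<Rightarrow> ('a \<Rightarrow> 'b::real_normed_vector) \<Rightarrow> bool" where
  "Ck_on 0 S f \<longleftrightarrow> continuous_on S f"
| "Ck_on (Suc k) S f \<longleftrightarrow>
     (\<forall>x\<in>S. f differentiable (at x)) \<and> (\<forall>v. Ck_on k S (\<lambda>x. frechet_derivative f (at x) v))"

definition smooth_on :: "'a::euclidean_space set \<Rightarrow> ('a \<Rightarrow> 'b::real_normed_vector) \<Rightarrow> bool" where
  "smooth_on S f \<longleftrightarrow> (\<forall>k. Ck_on k S f)"

text \<open>A chart is a pair of a domain and a coordinate map. The underlying set of a manifold is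
  a whole type of class \<open>t2_space\<close> and \<open>second_countable_topology\<close>; atlases need not be maximal.\<close>

type_synonym ('m, 'n) chart = "'m set \<times> ('m \<Rightarrow> real ^ 'n)"
type_synonym ('m, 'n) atlas = "('m, 'n) chart set"

definition param :: "('m, 'n) chart \<Rightarrow> real ^ 'n \<Rightarrow> 'm" where
  "param c = inv_into (fst c) (snd c)"

definition coords :: "('m, 'n) chart \<Rightarrow> 'm set \<Rightarrow> (real ^ 'n) set" where
  "coords c \<Omega> = snd c ` (fst c \<inter> \<Omega>)"

definition smooth_manifold ::
    "('m::{t2_space,second_countable_topology}, 'n::finite) atlas \<Rightarrow> bool" where
  "smooth_manifold A \<longleftrightarrow>
     (\<forall>c\<in>A. open (fst c) \<and> open (snd c ` fst c) \<and>
        homeomorphism (fst c) (snd c ` fst c) (snd c) (param c)) \<and>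
     (\<Union>c\<in>A. fst c) = UNIV \<and>
     (\<forall>c\<in>A. \<forall>c'\<in>A. smooth_on (coords c (fst c')) (snd c' \<circ> param c))"

definition smooth_map :: "('m::{t2_space,second_countable_topology}, 'n::finite) atlas \<Rightarrow>
    ('k::{t2_space,second_countable_topology}, 'p::finite) atlas \<Rightarrow> ('m \<Rightarrow> 'k) \<Rightarrow> bool" where
  "smooth_map A B F \<longleftrightarrow> continuous_on UNIV F \<and>
     (\<forall>c\<in>A. \<forall>c'\<in>B. smooth_on (coords c (F -` fst c')) (snd c' \<circ> F \<circ> param c))"

definition smooth_immersion :: "('m::{t2_space,second_countable_topology}, 'n::finite) atlas \<Rightarrow>
    ('k::{t2_space,second_countable_topology}, 'p::finite) atlas \<Rightarrow> ('m \<Rightarrow> 'k) \<Rightarrow> bool" where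
  "smooth_immersion A B F \<longleftrightarrow> smooth_map A B F \<and>
     (\<forall>c\<in>A. \<forall>c'\<in>B. \<forall>x\<in>coords c (F -` fst c').
        inj ((*v) (jacobian (snd c' \<circ> F \<circ> param c) (at x))))"


section \<open>Tensor fields in coordinates\<close>

text \<open>A tangent vector is given in each chart by its coordinate vector. A tensor field of type
  \<open>(0,2)\<close> or \<open>(1,1)\<close> assigns to each chart a matrix-valued function of the coordinates:
  a bilinear form \<open>T\<close> is \<open>(X, Y) \<mapsto> X \<bullet> (T *v Y)\<close> (entry \<open>i, j\<close> is \<open>T(\<partial>\<^sub>i, \<partial>\<^sub>j)\<close>) and an
  endomorphism \<open>T\<close> is \<open>X \<mapsto> T *v X\<close>. The components in different charts are
  related by the usual transformation laws. Only the values at coordinates of points of the set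
  on which the field is considered are relevant.\<close>

type_synonym ('m, 'n) field2 = "('m, 'n) chart \<Rightarrow> real ^ 'n \<Rightarrow> real ^ 'n ^ 'n"

definition bilinear_field ::
    "('m, 'n::finite) atlas \<Rightarrow> 'm set \<Rightarrow> ('m, 'n) field2 \<Rightarrow> bool" where
  "bilinear_field A \<Omega> T \<longleftrightarrow>
     (\<forall>c\<in>A. smooth_on (coords c \<Omega>) (T c)) \<and>
     (\<forall>c\<in>A. \<forall>c'\<in>A. \<forall>p \<in> fst c \<inter> fst c' \<inter> \<Omega>.
        let D = jacobian (snd c' \<circ> param c) (at (snd c p))
        in T c (snd c p) = transpose D ** T c' (snd c' p) ** D)"

definition endo_field ::
    "('m, 'n::finite) atlas \<Rightarrow> 'm set \<Rightarrow> ('m, 'n) field2 \<Rightarrow> bool" where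
  "endo_field A \<Omega> T \<longleftrightarrow>
     (\<forall>c\<in>A. smooth_on (coords c \<Omega>) (T c)) \<and>
     (\<forall>c\<in>A. \<forall>c'\<in>A. \<forall>p \<in> fst c \<inter> fst c' \<inter> \<Omega>.
        let D = jacobian (snd c' \<circ> param c) (at (snd c p))
        in D ** T c (snd c p) = T c' (snd c' p) ** D)"

definition riemannian_metric ::
    "('m, 'n::finite) atlas \<Rightarrow> ('m, 'n) field2 \<Rightarrow> bool" where
  "riemannian_metric A g \<longleftrightarrow> bilinear_field A UNIV g \<and>
     (\<forall>c\<in>A. \<forall>x\<in>coords c UNIV.
        transpose (g c x) = g c x \<and> (\<forall>u. u \<noteq> 0 \<longrightarrow> u \<bullet> (g c x *v u) > 0))"

text \<open>The pullback is computed in an arbitrarily chosen chart of the target around \<open>F p\<close>;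
  by the transformation law the result does not depend on the choice.\<close>

definition pullback :: "('k, 'p::finite) atlas \<Rightarrow> ('m \<Rightarrow> 'k) \<Rightarrow> ('k, 'p) field2 \<Rightarrow>
    ('m, 'n::finite) field2" where
  "pullback B F T c x =
     (let p = param c x;
          c' = (SOME c'. c' \<in> B \<and> F p \<in> fst c');
          D = jacobian (snd c' \<circ> F \<circ> param c) (at x)
      in transpose D ** T c' (snd c' (F p)) ** D)"


section \<open>Local Riemannian geometry\<close>

text \<open>Here \<open>G\<close> is the matrix of the metric as a function of the coordinates.\<close>

definition pd :: "'n::finite \<Rightarrow> (real ^ 'n \<Rightarrow> real) \<Rightarrow> real ^ 'n \<Rightarrow> real" where
  "pd i f x = frechet_derivative f (at x) (axis i 1)"

text \<open>\<open>christoffel G x k i j\<close> is \<open>\<Gamma>\<^sup>k\<^sub>i\<^sub>j\<close>.\<close>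

definition christoffel ::
    "(real ^ 'n \<Rightarrow> real ^ 'n ^ 'n) \<Rightarrow> real ^ 'n \<Rightarrow> 'n::finite \<Rightarrow> 'n \<Rightarrow> 'n \<Rightarrow> real" where
  "christoffel G x k i j = 1 / 2 * (\<Sum>l\<in>UNIV. matrix_inv (G x) $ k $ l *
     (pd i (\<lambda>y. G y $ j $ l) x + pd j (\<lambda>y. G y $ i $ l) x - pd l (\<lambda>y. G y $ i $ j) x))"

text \<open>\<open>riemann G x l k i j\<close> is the \<open>\<partial>\<^sub>l\<close>-component of \<open>R(\<partial>\<^sub>i, \<partial>\<^sub>j)\<partial>\<^sub>k\<close>, where
  \<open>R(X, Y) = \<nabla>\<^sub>X \<nabla>\<^sub>Y - \<nabla>\<^sub>Y \<nabla>\<^sub>X - \<nabla>\<^bsub>[X, Y]\<^esub>\<close>, and \<open>Ricci(Y, Z)\<close> is the trace of \<open>X \<mapsto> R(X, Y)Z\<close>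
  (so that round spheres have positive Ricci curvature).\<close>

definition riemann ::
    "(real ^ 'n \<Rightarrow> real ^ 'n ^ 'n) \<Rightarrow> real ^ 'n \<Rightarrow> 'n::finite \<Rightarrow> 'n \<Rightarrow> 'n \<Rightarrow> 'n \<Rightarrow> real" where
  "riemann G x l k i j =
     pd i (\<lambda>y. christoffel G y l j k) x - pd j (\<lambda>y. christoffel G y l i k) x
     + (\<Sum>m\<in>UNIV. christoffel G x l i m * christoffel G x m j k)
     - (\<Sum>m\<in>UNIV. christoffel G x l j m * christoffel G x m i k)"

definition ricci :: "(real ^ 'n \<Rightarrow> real ^ 'n ^ 'n) \<Rightarrow> real ^ 'n \<Rightarrow> real ^ 'n ^ 'n::finite" where
  "ricci G x = (\<chi> j k. \<Sum>i\<in>UNIV. riemann G x i k i j)"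

definition scalar_curvature ::
    "(real ^ 'n \<Rightarrow> real ^ 'n ^ 'n) \<Rightarrow> real ^ 'n::finite \<Rightarrow> real" where
  "scalar_curvature G x = trace (matrix_inv (G x) ** ricci G x)"

definition grad ::
    "(real ^ 'n \<Rightarrow> real ^ 'n ^ 'n) \<Rightarrow> (real ^ 'n \<Rightarrow> real) \<Rightarrow> real ^ 'n \<Rightarrow> real ^ 'n::finite" where
  "grad G f x = matrix_inv (G x) *v (\<chi> j. pd j f x)"

definition divergence ::
    "(real ^ 'n \<Rightarrow> real ^ 'n ^ 'n) \<Rightarrow> (real ^ 'n \<Rightarrow> real ^ 'n) \<Rightarrow> real ^ 'n::finite \<Rightarrow> real" where
  "divergence G X x =
     (\<Sum>i\<in>UNIV. pd i (\<lambda>y. X y $ i) x + (\<Sum>j\<in>UNIV. christoffel G x i i j * X x $ j))"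

definition laplacian ::
    "(real ^ 'n \<Rightarrow> real ^ 'n ^ 'n) \<Rightarrow> (real ^ 'n \<Rightarrow> real) \<Rightarrow> real ^ 'n::finite \<Rightarrow> real" where
  "laplacian G f = divergence G (grad G f)"

text \<open>\<open>nabla_endo G T x i k j\<close> is the \<open>\<partial>\<^sub>k\<close>-component of \<open>(\<nabla>\<^sub>i T)\<partial>\<^sub>j\<close>.\<close>

definition nabla_endo :: "(real ^ 'n \<Rightarrow> real ^ 'n ^ 'n) \<Rightarrow> (real ^ 'n \<Rightarrow> real ^ 'n ^ 'n) \<Rightarrow>
    real ^ 'n \<Rightarrow> 'n::finite \<Rightarrow> 'n \<Rightarrow> 'n \<Rightarrow> real" where
  "nabla_endo G T x i k j = pd i (\<lambda>y. T y $ k $ j) x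
     + (\<Sum>l\<in>UNIV. christoffel G x k i l * T x $ l $ j)
     - (\<Sum>l\<in>UNIV. christoffel G x l i j * T x $ k $ l)"

text \<open>A one-form is a function of the coordinates and a coordinate vector. The convention is
  \<open>d\<alpha>(X, Y) = X(\<alpha>(Y)) - Y(\<alpha>(X)) - \<alpha>([X, Y])\<close>, without a factor \<open>1/2\<close>; the bracket
  vanishes for the constant extensions of \<open>u\<close> and \<open>v\<close>.\<close>

definition ext_d1 ::
    "(real ^ 'n \<Rightarrow> real ^ 'n \<Rightarrow> real) \<Rightarrow> real ^ 'n::finite \<Rightarrow> real ^ 'n \<Rightarrow> real ^ 'n \<Rightarrow> real" where
  "ext_d1 \<alpha> x u v =
     frechet_derivative (\<lambda>y. \<alpha> y v) (at x) u - frechet_derivative (\<lambda>y. \<alpha> y u) (at x) v"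


section \<open>Kaehler structures\<close>

definition kaehler_on :: "('m, 'n::finite) atlas \<Rightarrow> 'm set \<Rightarrow> ('m, 'n) field2 \<Rightarrow>
    ('m, 'n) field2 \<Rightarrow> bool" where
  "kaehler_on A \<Omega> g J \<longleftrightarrow> endo_field A \<Omega> J \<and>
     (\<forall>c\<in>A. \<forall>x\<in>coords c \<Omega>.
        J c x ** J c x = - mat 1 \<and>
        (\<forall>u v. (J c x *v u) \<bullet> (g c x *v (J c x *v v)) = u \<bullet> (g c x *v v)) \<and>
        (\<forall>i k j. nabla_endo (g c) (J c) x i k j = 0))"

definition einstein :: "('m, 'n::finite) atlas \<Rightarrow> ('m, 'n) field2 \<Rightarrow> bool" where
  "einstein A g \<longleftrightarrow> (\<exists>r. \<forall>c\<in>A. \<forall>x\<in>coords c UNIV. ricci (g c) x = r *\<^sub>R g c x)"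

definition ricci_flat :: "('m, 'n::finite) atlas \<Rightarrow> ('m, 'n) field2 \<Rightarrow> bool" where
  "ricci_flat A g \<longleftrightarrow> (\<forall>c\<in>A. \<forall>x\<in>coords c UNIV. ricci (g c) x = 0)"

definition kaehler_einstein ::
    "('m, 'n::finite) atlas \<Rightarrow> ('m, 'n) field2 \<Rightarrow> ('m, 'n) field2 \<Rightarrow> bool" where
  "kaehler_einstein A g J \<longleftrightarrow>
     riemannian_metric A g \<and> kaehler_on A UNIV g J \<and> einstein A g"

text \<open>\<open>\<omega>(X, Y) = g(JX, Y)\<close>\<close>

definition kaehler_form :: "('m, 'n::finite) field2 \<Rightarrow> ('m, 'n) field2 \<Rightarrow> ('m, 'n) field2" where
  "kaehler_form g J c x = transpose (J c x) ** g c x"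


section \<open>Kaehler angles\<close>

definition sharp :: "('m, 'n::finite) field2 \<Rightarrow> ('m, 'n) field2 \<Rightarrow> ('m, 'n) field2" where
  "sharp g W c x =
     (THE S. \<forall>u v. (S *v u) \<bullet> (g c x *v v) = u \<bullet> (W c x *v v))"

definition complex_eigenvalue :: "real ^ 'n ^ 'n \<Rightarrow> complex \<Rightarrow> bool" where
  "complex_eigenvalue S z \<longleftrightarrow> (\<exists>v :: complex ^ 'n. v \<noteq> 0 \<and>
     (\<chi> i j. complex_of_real (S $ i $ j)) *v v = z *s v)"

text \<open>\<open>(F\<^sup>*\<omega>)\<^sup>\<sharp>\<close>, taken with respect to the induced metric\<close>

definition pullback_omega_sharp :: "('k, 'p::finite) atlas \<Rightarrow> ('k, 'p) field2 \<Rightarrow>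
    ('k, 'p) field2 \<Rightarrow> ('m \<Rightarrow> 'k) \<Rightarrow> ('m, 'n::finite) field2" where
  "pullback_omega_sharp B h J F =
     sharp (pullback B F h) (pullback B F (kaehler_form h J))"

definition equal_kaehler_angles :: "('m, 'n::finite) atlas \<Rightarrow> ('k, 'p::finite) atlas \<Rightarrow>
    ('k, 'p) field2 \<Rightarrow> ('k, 'p) field2 \<Rightarrow> ('m \<Rightarrow> 'k) \<Rightarrow> ('m \<Rightarrow> real) \<Rightarrow> bool" where
  "equal_kaehler_angles A B h J F \<theta> \<longleftrightarrow>
     (\<forall>p. 0 \<le> \<theta> p \<and> \<theta> p \<le> pi / 2) \<and>
     (\<forall>c\<in>A. \<forall>p\<in>fst c. \<forall>z.
        complex_eigenvalue (pullback_omega_sharp B h J F c (snd c p)) z \<longrightarrow>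
          z = \<i> * complex_of_real (cos (\<theta> p)) \<or> z = - (\<i> * complex_of_real (cos (\<theta> p))))"

text \<open>\<open>(F\<^sup>*\<omega>)\<^sup>\<sharp> = cos \<theta> J\<^sub>\<omega>\<close>; meaningful where \<open>cos \<theta> \<noteq> 0\<close>\<close>

definition J_omega :: "('k, 'p::finite) atlas \<Rightarrow> ('k, 'p) field2 \<Rightarrow> ('k, 'p) field2 \<Rightarrow>
    ('m \<Rightarrow> 'k) \<Rightarrow> ('m \<Rightarrow> real) \<Rightarrow> ('m, 'n::finite) field2" where
  "J_omega B h J F \<theta> c x =
     (1 / cos (\<theta> (param c x))) *\<^sub>R pullback_omega_sharp B h J F c x"

definition I_kaehler_on :: "('m, 'n::finite) atlas \<Rightarrow> ('k, 'p::finite) atlas \<Rightarrow>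
    ('k, 'p) field2 \<Rightarrow> ('k, 'p) field2 \<Rightarrow> ('m \<Rightarrow> 'k) \<Rightarrow> ('m \<Rightarrow> real) \<Rightarrow> 'm set \<Rightarrow>
    ('m, 'n) field2 \<Rightarrow> bool" where
  "I_kaehler_on A B h J F \<theta> \<Omega> I \<longleftrightarrow>
     kaehler_on A \<Omega> (pullback B F h) I \<and>
     (\<forall>c\<in>A. \<forall>x\<in>coords c \<Omega>.
        I c x ** J_omega B h J F \<theta> c x = - (J_omega B h J F \<theta> c x ** I c x))"

end

theory Submission
  imports Defs
begin

text \<open>
  The form \<open>F\<^sup>*\<omega>\<close> is closed, and
  \<open>S = (F\<^sup>*\<omega>)\<^sup>\<sharp>\<close> is skew, satisfies \<open>S\<^sup>2 = - cos\<^sup>2\<theta>\<close> and anti-commutes with \<open>I\<close>; hence \<open>F\<^sup>*\<omega>\<close> is the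
  real part of a nowhere vanishing holomorphic section of the canonical bundle of \<open>(M, I)\<close>, with
  squared norm proportional to \<open>cos\<^sup>2\<theta>\<close>, and the Ricci form is the curvature of that bundle.

  Complex coordinates are avoided as follows. In dimension four \<open>S\<close> and \<open>I S\<close> span the skew
  endomorphisms anti-commuting with \<open>I\<close>, so that \<open>\<nabla>\<^sub>X S = \<mu>(X) S + \<nu>(X) I S\<close> with
  \<open>\<mu> = d log cos\<^sup>2\<theta> / 2\<close>, and closedness of \<open>F\<^sup>*\<omega>\<close> forces \<open>\<nu> = \<mu> \<circ> I\<close>. Then
  \<open>[R(X, Y), S] = d\<nu>(X, Y) I S\<close>, and taking the trace against \<open>I S\<close> yields
  \<open>tr (R(X, Y) I) = - 2 d\<nu>(X, Y)\<close>, while the left-hand side is \<open>2 Ricci(I X, Y)\<close> on any Kaehler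
  manifold. The scalar curvature is the trace of the Ricci identity.
\<close>

section \<open>Calculus of k times continuously differentiable maps\<close>

text \<open>Two objects come without visible regularity. The angle \<open>\<theta>\<close> is an
  arbitrary function, so the differentiability of \<open>cos^2 \<theta>\<close> is read off from the
  entries of \<open>S^2\<close>; and \<open>pullback\<close> picks a target chart separately at each
  point, so the smoothness of the metric and of \<open>S\<close> appears only after one target chart
  has been fixed near the point. The hypothesis on complex eigenvalues becomes a polynomial identity
  for \<open>S^2\<close> through the extreme values of a Rayleigh quotient, since \<open>S^2\<close>
  is symmetric for \<open>g\<close>.

  The constants have these origins. The squared norm of \<open>S\<close> is proportional to
  \<open>cos^2 \<theta>\<close>, so \<open>\<mu>\<close> carries a factor 1/2. In the trace against
  \<open>I S\<close>, cyclicity replaces \<open>[R, S]\<close> by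
  \<open>[S, I S] = 2 cos^2 \<theta> I\<close>, while \<open>(I S)^2 = - cos^2 \<theta>\<close> has
  trace \<open>- 4 cos^2 \<theta>\<close> in dimension four; the quotient is the factor -2. The 2 in
  front of Ricci and the half inside \<open>\<nu>\<close> then leave the -1/2 of the
  theorem.\<close>

abbreviation (input) fd :: "('a::real_normed_vector \<Rightarrow> 'b::real_normed_vector) \<Rightarrow> 'a \<Rightarrow> 'a \<Rightarrow> 'b" where
  "fd f x \<equiv> frechet_derivative f (at x)"

lemma fd_unique: "(f has_derivative f') (at x) \<Longrightarrow> fd f x = f'"
  by (metis frechet_derivative_at)

lemma Ck_on_SucD:
  "Ck_on (Suc k) S f \<Longrightarrow> x \<in> S \<Longrightarrow> (f has_derivative fd f x) (at x)"
  by (simp add: frechet_derivative_works[symmetric])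

text \<open>\<open>Ck_on\<close> speaks of derivatives in the full space; openness of
  \<open>S\<close> makes them depend only on the values on \<open>S\<close>.\<close>

lemma Ck_on_cong:
  assumes "open S" and "\<And>x. x \<in> S \<Longrightarrow> f x = g x" and "Ck_on k S f"
  shows "Ck_on k S g"
  using assms(2,3)
proof (induction k arbitrary: f g)
  case 0
  then show ?case using continuous_on_cong by force
next
  case (Suc k)
  have d: "(g has_derivative fd f x) (at x)" if "x \<in> S" for x
    using has_derivative_transform_within_open[OF Ck_on_SucD[OF Suc.prems(2) that] \<open>open S\<close> that] Suc.prems(1)
    by auto
  have "Ck_on k S (\<lambda>x. fd g x v)" for v
    by (rule Suc.IH[of "\<lambda>x. fd f x v"]) (use Suc.prems fd_unique[OF d] in auto)
  then show ?case using d by (auto simp: differentiable_def)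
qed

text \<open>Any derivative formula valid on \<open>S\<close> may stand in for
  \<open>frechet_derivative\<close>; the closure properties below go through this rule.\<close>

lemma Ck_on_SucI:
  assumes "open S" and "\<And>x. x \<in> S \<Longrightarrow> (f has_derivative f' x) (at x)"
    and "\<And>v. Ck_on k S (\<lambda>x. f' x v)"
  shows "Ck_on (Suc k) S f"
proof -
  have "Ck_on k S (\<lambda>x. fd f x v)" for v
    by (rule Ck_on_cong[OF assms(1) _ assms(3)[of v]]) (use fd_unique[OF assms(2)] in auto)
  then show ?thesis using assms(2) by (auto simp: differentiable_def)
qed

lemma Ck_on_Suc_imp: "Ck_on (Suc k) S f \<Longrightarrow> Ck_on k S f"
proof (induction k arbitrary: f)
  case 0
  then show ?case
    by (auto intro!: continuous_at_imp_continuous_on differentiable_imp_continuous_within)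
next
  case (Suc k)
  then show ?case by (metis Ck_on.simps(2))
qed

lemma Ck_on_le: "Ck_on m S f \<Longrightarrow> k \<le> m \<Longrightarrow> Ck_on k S f"
  by (induction m) (use Ck_on_Suc_imp le_Suc_eq in blast)+

lemma Ck_on_subset: "Ck_on k S f \<Longrightarrow> T \<subseteq> S \<Longrightarrow> Ck_on k T f"
  by (induction k arbitrary: f) (auto intro: continuous_on_subset)

lemma Ck_on_const: "Ck_on k S (\<lambda>x. c)"
  by (induction k arbitrary: c) auto

lemma Ck_on_linear:
  assumes "open S" "bounded_linear l" "Ck_on k S f"
  shows "Ck_on k S (\<lambda>x. l (f x))"
  using assms(3)
proof (induction k arbitrary: f)
  case 0
  then show ?case by (simp add: bounded_linear.continuous_on[OF assms(2)])
next
  case (Suc k)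
  show ?case
    by (rule Ck_on_SucI[OF assms(1) bounded_linear.has_derivative[OF assms(2) Ck_on_SucD[OF Suc.prems]]])
      (use Suc in auto)
qed

lemma Ck_on_add:
  assumes "open S" "Ck_on k S f" "Ck_on k S g"
  shows "Ck_on k S (\<lambda>x. f x + g x)"
  using assms(2,3)
proof (induction k arbitrary: f g)
  case 0
  then show ?case by (auto intro: continuous_on_add)
next
  case (Suc k)
  show ?case
    by (rule Ck_on_SucI[OF assms(1) has_derivative_add[OF Ck_on_SucD[OF Suc.prems(1)] Ck_on_SucD[OF Suc.prems(2)]]])
      (use Suc in auto)
qed

lemma Ck_on_sum:
  assumes "open S" "\<And>i. i \<in> A \<Longrightarrow> Ck_on k S (f i)"
  shows "Ck_on k S (\<lambda>x. \<Sum>i\<in>A. f i x)"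
  using assms(2)
  by (induction A rule: infinite_finite_induct) (auto simp: Ck_on_const Ck_on_add[OF assms(1)])

lemma Ck_on_bilinear:
  assumes "open S" "bounded_bilinear p" "Ck_on k S f" "Ck_on k S g"
  shows "Ck_on k S (\<lambda>x. p (f x) (g x))"
  using assms(3,4)
proof (induction k arbitrary: f g)
  case 0
  then show ?case by (auto intro: bounded_bilinear.continuous_on[OF assms(2)])
next
  case (Suc k)
  show ?case
    by (rule Ck_on_SucI[OF assms(1) bounded_bilinear.FDERIV[OF assms(2) Ck_on_SucD[OF Suc.prems(1)] Ck_on_SucD[OF Suc.prems(2)]]])
      (use Suc Suc.prems[THEN Ck_on_Suc_imp] in \<open>auto intro!: Ck_on_add[OF assms(1)]\<close>)
qed

lemmas Ck_on_mult = Ck_on_bilinear[OF _ bounded_bilinear_mult]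
lemmas Ck_on_scaleR = Ck_on_bilinear[OF _ bounded_bilinear_scaleR]

lemma Ck_on_uminus: "open S \<Longrightarrow> Ck_on k S f \<Longrightarrow> Ck_on k S (\<lambda>x. - f x)"
  by (rule Ck_on_linear[OF _ bounded_linear_minus[OF bounded_linear_ident]])

lemma Ck_on_diff: "open S \<Longrightarrow> Ck_on k S f \<Longrightarrow> Ck_on k S g \<Longrightarrow> Ck_on k S (\<lambda>x. f x - g x)"
  using Ck_on_add[of S k f "\<lambda>x. - g x"] Ck_on_uminus[of S k g] by simp

lemma Ck_on_prod:
  fixes f :: "'i \<Rightarrow> 'a::euclidean_space \<Rightarrow> real"
  assumes "open S" "\<And>i. i \<in> A \<Longrightarrow> Ck_on k S (f i)"
  shows "Ck_on k S (\<lambda>x. \<Prod>i\<in>A. f i x)"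
  using assms(2)
  by (induction A rule: infinite_finite_induct) (auto simp: Ck_on_const Ck_on_mult[OF assms(1)])

lemma Ck_on_compose:
  fixes f :: "'a::euclidean_space \<Rightarrow> 'b::euclidean_space" and g :: "'b \<Rightarrow> 'c::real_normed_vector"
  assumes "open S" "f ` S \<subseteq> T" "Ck_on k S f" "Ck_on k T g"
  shows "Ck_on k S (\<lambda>x. g (f x))"
  using assms(3,4)
proof (induction k arbitrary: g)
  case 0
  then show ?case using assms(2) by (auto intro: continuous_on_compose2)
next
  case (Suc k)
  have d: "((\<lambda>x. g (f x)) has_derivative (\<lambda>v. fd g (f x) (fd f x v))) (at x)" if "x \<in> S" for x
    using has_derivative_compose[OF Ck_on_SucD[OF Suc.prems(1) that] Ck_on_SucD[OF Suc.prems(2)]] assms(2) that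
    by auto
  \<comment> \<open>In \<open>fd g (f x) (fd f x v)\<close> the direction varies with
    \<open>x\<close>, whereas \<open>Ck_on\<close> controls fixed directions only. The basis
    expansion turns it into a sum of products of controlled functions.\<close>
  have e: "fd g (f x) w = (\<Sum>b\<in>Basis. (w \<bullet> b) *\<^sub>R fd g (f x) b)" if "x \<in> S" for x w
  proof -
    have "linear (fd g (f x))"
      using that assms(2) Suc.prems(2) linear_frechet_derivative by auto
    then show ?thesis
      by (subst euclidean_representation[symmetric]) (simp only: linear_sum linear_scale)
  qed
  have f: "Ck_on k S f" using Suc.prems(1) by (rule Ck_on_Suc_imp)
  have "Ck_on k S (\<lambda>x. \<Sum>b\<in>Basis. (fd f x v \<bullet> b) *\<^sub>R fd g (f x) b)" for v
    by (intro Ck_on_sum Ck_on_scaleR assms(1) Ck_on_linear[OF _ bounded_linear_inner_left] Suc.IH f)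
      (use Suc.prems in auto)
  then have "Ck_on k S (\<lambda>x. fd g (f x) (fd f x v))" for v
    by (rule Ck_on_cong[OF assms(1), rotated]) (use e in auto)
  then show ?case using Ck_on_SucI[OF assms(1) d] by blast
qed

lemma Ck_on_inverse:
  fixes f :: "'a::euclidean_space \<Rightarrow> real"
  assumes "open S" "Ck_on k S f" "\<And>x. x \<in> S \<Longrightarrow> f x \<noteq> 0"
  shows "Ck_on k S (\<lambda>x. inverse (f x))"
  using assms(2)
proof (induction k)
  case 0
  then show ?case using assms(3) by (auto intro: continuous_on_inverse)
next
  case (Suc k)
  \<comment> \<open>The derivative of \<open>inverse (f x)\<close> contains
    \<open>inverse (f x)\<close> again, one order lower.\<close>
  have i: "Ck_on k S (\<lambda>x. inverse (f x))" using Suc Ck_on_Suc_imp by blast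
  show ?case
    by (rule Ck_on_SucI[OF assms(1) Deriv.has_derivative_inverse[OF assms(3) Ck_on_SucD[OF Suc.prems]]])
      (use i Suc.prems in \<open>auto intro!: Ck_on_uminus Ck_on_mult assms(1)\<close>)
qed

lemma Ck_on_ln:
  fixes f :: "'a::euclidean_space \<Rightarrow> real"
  assumes "open S" "Ck_on k S f" "\<And>x. x \<in> S \<Longrightarrow> f x > 0"
  shows "Ck_on k S (\<lambda>x. ln (f x))"
proof (cases k)
  case 0
  then show ?thesis using assms(2,3) by (fastforce intro: continuous_on_ln)
next
  case (Suc m)
  have "Ck_on m S f" using assms(2) Suc Ck_on_Suc_imp by blast
  then have i: "Ck_on m S (\<lambda>x. inverse (f x))" using assms Ck_on_inverse by force
  show ?thesis unfolding Suc
  proof (rule Ck_on_SucI[OF assms(1), of _ "\<lambda>x v. inverse (f x) * fd f x v"])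
    show "((\<lambda>x. ln (f x)) has_derivative (\<lambda>v. inverse (f x) * fd f x v)) (at x)" if "x \<in> S" for x
      using has_derivative_ln[OF assms(3)[OF that] Ck_on_SucD[OF assms(2)[unfolded Suc] that]]
      by (simp add: mult.commute)
    show "Ck_on m S (\<lambda>x. inverse (f x) * fd f x v)" for v
      using i assms(2) Suc by (auto intro!: Ck_on_mult assms(1))
  qed
qed

lemma bounded_linear_axis:
  "bounded_linear (axis i :: 'b::euclidean_space \<Rightarrow> 'b ^ 'n::finite)"
  unfolding linear_conv_bounded_linear[symmetric]
  by (auto intro!: linearI simp: axis_def vec_eq_iff)

lemma Ck_on_vec:
  fixes f :: "'a::euclidean_space \<Rightarrow> 'b::euclidean_space ^ 'n::finite"
  assumes "open S" "\<And>i. Ck_on k S (\<lambda>x. f x $ i)"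
  shows "Ck_on k S f"
proof -
  have "f = (\<lambda>x. \<Sum>i\<in>UNIV. axis i (f x $ i))"
    by (auto simp: vec_eq_iff axis_def if_distrib cong: if_cong)
  then show ?thesis
    by (rule ssubst) (intro Ck_on_sum Ck_on_linear[OF _ bounded_linear_axis] assms)
qed

lemma Ck_on_nth:
  "open S \<Longrightarrow> Ck_on k S f \<Longrightarrow> Ck_on k S (\<lambda>x. f x $ i)"
  by (rule Ck_on_linear[OF _ bounded_linear_vec_nth])

section \<open>Symmetry of second derivatives\<close>

lemma second_difference:
  fixes f :: "'a::euclidean_space \<Rightarrow> real"
  assumes "Ck_on 2 S f" "h > 0"
    and S: "\<And>s t. 0 \<le> s \<Longrightarrow> s \<le> h \<Longrightarrow> 0 \<le> t \<Longrightarrow> t \<le> h \<Longrightarrow> x + s *\<^sub>R u + t *\<^sub>R v \<in> S"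
  shows "\<exists>\<xi>>0. \<exists>\<eta>>0. \<xi> < h \<and> \<eta> < h \<and>
    f (x + h *\<^sub>R u + h *\<^sub>R v) - f (x + h *\<^sub>R u) - f (x + h *\<^sub>R v) + f x
      = h * (h * fd (\<lambda>y. fd f y u) (x + \<xi> *\<^sub>R u + \<eta> *\<^sub>R v) v)"
proof -
  have f1: "(f has_derivative fd f y) (at y)" if "y \<in> S" for y
    using Ck_on_SucD[of 1 S f] assms(1) that by (simp add: numeral_2_eq_2)
  have f2: "((\<lambda>y. fd f y u) has_derivative fd (\<lambda>y. fd f y u) y) (at y)" if "y \<in> S" for y
    using Ck_on_SucD[of 0 S "\<lambda>y. fd f y u"] assms(1) that by (simp add: numeral_2_eq_2)
  have lin: "c * fd g y w = fd g y (c *\<^sub>R w)" if "g differentiable at y" for c w y and g :: "'a \<Rightarrow> real"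
    using linear_scale[OF linear_frechet_derivative[OF that]] by simp
  have line: "((\<lambda>s. g (p + s *\<^sub>R w)) has_real_derivative fd g (p + s *\<^sub>R w) w) (at s)"
    if "(g has_derivative fd g (p + s *\<^sub>R w)) (at (p + s *\<^sub>R w))" for s p w and g :: "'a \<Rightarrow> real"
  proof -
    have "((\<lambda>s. p + s *\<^sub>R w) has_derivative (\<lambda>c. c *\<^sub>R w)) (at s)"
      by (auto intro!: derivative_eq_intros)
    from has_derivative_compose[OF this that]
    have "((\<lambda>s. g (p + s *\<^sub>R w)) has_derivative (\<lambda>c. fd g (p + s *\<^sub>R w) (c *\<^sub>R w))) (at s)" .
    moreover have "g differentiable at (p + s *\<^sub>R w)" using that by (auto simp: differentiable_def)
    ultimately show ?thesis
      by (simp add: has_field_derivative_def lin[symmetric] mult.commute[of _ "fd g (p + s *\<^sub>R w) w"])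
  qed
  \<comment> \<open>The first difference in direction \<open>v\<close>. Its increment over
    \<open>[0, h]\<close> is the second difference over the parallelogram, and the mean value
    theorem is applied first in \<open>s\<close> and then along \<open>v\<close>.\<close>
  define \<phi> where "\<phi> s = f ((x + h *\<^sub>R v) + s *\<^sub>R u) - f (x + s *\<^sub>R u)" for s
  have "DERIV \<phi> s :> fd f ((x + h *\<^sub>R v) + s *\<^sub>R u) u - fd f (x + s *\<^sub>R u) u"
    if "0 \<le> s" "s \<le> h" for s
    unfolding \<phi>_def
    using line[OF f1, of "x + h *\<^sub>R v" s u] line[OF f1, of x s u] S[of s h] S[of s 0] that assms(2)
    by (intro DERIV_diff) (auto simp: add_ac)
  from MVT2[OF assms(2) this] obtain \<xi> where \<xi>: "0 < \<xi>" "\<xi> < h"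
    and 1: "\<phi> h - \<phi> 0 = h * (fd f ((x + h *\<^sub>R v) + \<xi> *\<^sub>R u) u - fd f (x + \<xi> *\<^sub>R u) u)"
    by auto
  have "DERIV (\<lambda>t. fd f ((x + \<xi> *\<^sub>R u) + t *\<^sub>R v) u) t :> fd (\<lambda>y. fd f y u) (x + \<xi> *\<^sub>R u + t *\<^sub>R v) v"
    if "0 \<le> t" "t \<le> h" for t
    using line[OF f2, of "x + \<xi> *\<^sub>R u" t v] S[of \<xi> t] that \<xi> by simp
  from MVT2[OF assms(2) this] obtain \<eta> where \<eta>: "0 < \<eta>" "\<eta> < h"
    and 2: "fd f ((x + \<xi> *\<^sub>R u) + h *\<^sub>R v) u - fd f (x + \<xi> *\<^sub>R u) u
      = h * fd (\<lambda>y. fd f y u) (x + \<xi> *\<^sub>R u + \<eta> *\<^sub>R v) v"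
    by auto
  have 3: "x + h *\<^sub>R v + \<xi> *\<^sub>R u = x + \<xi> *\<^sub>R u + h *\<^sub>R v" "x + h *\<^sub>R v + h *\<^sub>R u = x + h *\<^sub>R u + h *\<^sub>R v"
    by (simp_all add: add_ac)
  show ?thesis
    using \<xi> \<eta> 1 unfolding \<phi>_def 3 2
    by (intro exI[of _ \<xi>] exI[of _ \<eta>] conjI) (simp_all add: algebra_simps)
qed

lemma second_derivative_symmetric_real:
  fixes f :: "'a::euclidean_space \<Rightarrow> real"
  assumes "open S" "Ck_on 2 S f" "x \<in> S"
  shows "fd (\<lambda>y. fd f y u) x v = fd (\<lambda>y. fd f y v) x u"
proof (rule ccontr)
  define A where "A y = fd (\<lambda>y. fd f y u) y v" for y
  define B where "B y = fd (\<lambda>y. fd f y v) y u" for y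
  assume "\<not> ?thesis"
  \<comment> \<open>Half the gap: a common value of \<open>A\<close> and \<open>B\<close> at nearby
    points, within this distance of both \<open>A x\<close> and \<open>B x\<close>, contradicts the
    triangle inequality.\<close>
  then have e: "\<bar>A x - B x\<bar> / 2 > 0" (is "?e > 0") by (simp add: A_def B_def)
  have "continuous_on S A" "continuous_on S B"
    using assms(2) unfolding A_def B_def by (auto simp: numeral_2_eq_2)
  then have "isCont A x" "isCont B x"
    using assms(1,3) continuous_on_eq_continuous_at by blast+
  then obtain d1 d2 where d1: "d1 > 0" "\<And>y. dist y x < d1 \<Longrightarrow> dist (A y) (A x) < ?e"
    and d2: "d2 > 0" "\<And>y. dist y x < d2 \<Longrightarrow> dist (B y) (B x) < ?e"
    using e unfolding continuous_at_eps_delta by (metis)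
  obtain d3 where d3: "d3 > 0" "ball x d3 \<subseteq> S" using assms(1,3) openE by blast
  define d where "d = Min {d1, d2, d3}"
  have d: "d > 0" "d \<le> d1" "d \<le> d2" "d \<le> d3" using d1 d2 d3 by (auto simp: d_def)
  \<comment> \<open>Small enough for the whole parallelogram to stay within \<open>d\<close> of
    \<open>x\<close>; the summand 1 covers the case of vanishing \<open>u\<close> and
    \<open>v\<close>.\<close>
  define h where "h = d / (2 * (norm u + norm v + 1))"
  have nn: "norm u + norm v + 1 > 0" by (simp add: add_nonneg_pos)
  have h: "h > 0" using d nn by (simp add: h_def)
  have near: "dist (x + s *\<^sub>R u + t *\<^sub>R v) x < d" if "0 \<le> s" "s \<le> h" "0 \<le> t" "t \<le> h" for s t
  proof -
    have "dist (x + s *\<^sub>R u + t *\<^sub>R v) x = norm (s *\<^sub>R u + t *\<^sub>R v)" by (simp add: dist_norm add.assoc)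
    also have "\<dots> \<le> s * norm u + t * norm v" using that by (metis abs_of_nonneg norm_scaleR norm_triangle_ineq)
    also have "\<dots> \<le> h * norm u + h * norm v" using that by (intro add_mono mult_right_mono) auto
    also have "\<dots> \<le> h * (norm u + norm v + 1)" using h by (simp add: algebra_simps)
    also have "\<dots> = d / 2" using nn by (simp add: h_def field_simps)
    also have "\<dots> < d" using d by simp
    finally show ?thesis .
  qed
  have S: "x + s *\<^sub>R u + t *\<^sub>R v \<in> S" if "0 \<le> s" "s \<le> h" "0 \<le> t" "t \<le> h" for s t
    using near[OF that] d d3 by (auto simp: dist_commute)
  have S': "x + s *\<^sub>R v + t *\<^sub>R u \<in> S" if "0 \<le> s" "s \<le> h" "0 \<le> t" "t \<le> h" for s t
    using S[of t s] that by (simp add: add_ac)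
  obtain a b where ab: "0 < a" "a < h" "0 < b" "b < h"
    "f (x + h *\<^sub>R u + h *\<^sub>R v) - f (x + h *\<^sub>R u) - f (x + h *\<^sub>R v) + f x
      = h * (h * A (x + a *\<^sub>R u + b *\<^sub>R v))"
    using second_difference[OF assms(2) h S] by (fastforce simp: A_def)
  obtain a' b' where ab': "0 < a'" "a' < h" "0 < b'" "b' < h"
    "f (x + h *\<^sub>R v + h *\<^sub>R u) - f (x + h *\<^sub>R v) - f (x + h *\<^sub>R u) + f x
      = h * (h * B (x + a' *\<^sub>R v + b' *\<^sub>R u))"
    using second_difference[OF assms(2) h S'] by (fastforce simp: B_def)
  have c: "x + h *\<^sub>R v + h *\<^sub>R u = x + h *\<^sub>R u + h *\<^sub>R v" by (simp add: add_ac)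
  have "h * (h * A (x + a *\<^sub>R u + b *\<^sub>R v)) = h * (h * B (x + a' *\<^sub>R v + b' *\<^sub>R u))"
    using ab(5) ab'(5)[unfolded c] by linarith
  then have AB: "A (x + a *\<^sub>R u + b *\<^sub>R v) = B (x + a' *\<^sub>R v + b' *\<^sub>R u)"
    using h by simp
  have "dist (A (x + a *\<^sub>R u + b *\<^sub>R v)) (A x) < ?e"
    using near[of a b] ab d by (intro d1) auto
  moreover have "dist (B (x + a' *\<^sub>R v + b' *\<^sub>R u)) (B x) < ?e"
    using near[of b' a'] ab' d by (intro d2) (auto simp: add_ac)
  ultimately show False unfolding AB dist_real_def abs_less_iff by (simp add: abs_if split: if_splits)
qed

lemma second_derivative_symmetric:
  fixes f :: "'a::euclidean_space \<Rightarrow> 'b::euclidean_space"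
  assumes "open S" "Ck_on 2 S f" "x \<in> S"
  shows "fd (\<lambda>y. fd f y u) x v = fd (\<lambda>y. fd f y v) x u"
proof (rule euclidean_eqI)
  fix b :: 'b
  have f1: "fd (\<lambda>y. f y \<bullet> b) y w = fd f y w \<bullet> b" if "y \<in> S" for y w
    using fd_unique[OF bounded_linear.has_derivative[OF bounded_linear_inner_left Ck_on_SucD]] that assms(2)
    by (metis numeral_2_eq_2)
  have f2: "fd (\<lambda>y. fd (\<lambda>y. f y \<bullet> b) y u) x v = fd (\<lambda>y. fd f y u) x v \<bullet> b" for u v
  proof -
    have "((\<lambda>y. fd f y u \<bullet> b) has_derivative (\<lambda>v. fd (\<lambda>y. fd f y u) x v \<bullet> b)) (at x)"
      by (rule bounded_linear.has_derivative[OF bounded_linear_inner_left Ck_on_SucD[of 0 S]])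
        (use assms in \<open>auto simp: numeral_2_eq_2\<close>)
    then have "((\<lambda>y. fd (\<lambda>y. f y \<bullet> b) y u) has_derivative (\<lambda>v. fd (\<lambda>y. fd f y u) x v \<bullet> b)) (at x)"
      by (rule has_derivative_transform_within_open[OF _ assms(1,3)]) (simp add: f1)
    then show ?thesis by (simp add: fd_unique)
  qed
  have "Ck_on 2 S (\<lambda>y. f y \<bullet> b)"
    by (rule Ck_on_linear[OF assms(1) bounded_linear_inner_left assms(2)])
  from second_derivative_symmetric_real[OF assms(1) this assms(3), of u v]
  show "fd (\<lambda>y. fd f y u) x v \<bullet> b = fd (\<lambda>y. fd f y v) x u \<bullet> b"
    unfolding f2 .
qed

section \<open>Matrix algebra and derivatives of matrix-valued maps\<close>

lemma matrix_sub_ldistrib: "A ** (B - C) = A ** B - A ** C" for A :: "'a::ring_1^'n^'m"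
  by (simp add: matrix_matrix_mult_def vec_eq_iff right_diff_distrib sum_subtractf)

lemma matrix_add_rdistrib: "(A + B) ** C = A ** C + B ** C" for A :: "'a::semiring_1^'n^'m"
  by (simp add: matrix_matrix_mult_def vec_eq_iff distrib_right sum.distrib)

lemma matrix_sub_rdistrib: "(A - B) ** C = A ** C - B ** C" for A :: "'a::ring_1^'n^'m"
  by (simp add: matrix_matrix_mult_def vec_eq_iff left_diff_distrib sum_subtractf)

lemma matrix_scaleR_left: "(c *\<^sub>R A) ** B = c *\<^sub>R (A ** B)" for A :: "real^'n^'m"
  by (simp add: matrix_matrix_mult_def vec_eq_iff sum_distrib_left mult.assoc)

lemma matrix_scaleR_right: "A ** (c *\<^sub>R B) = c *\<^sub>R (A ** B)" for A :: "real^'n^'m"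
  by (simp add: matrix_matrix_mult_def vec_eq_iff sum_distrib_left mult.left_commute)

lemma matrix_minus_left: "(- A) ** B = - (A ** B)" for A :: "real^'n^'m"
  by (simp add: matrix_matrix_mult_def vec_eq_iff sum_negf)

lemma matrix_minus_right: "A ** (- B) = - (A ** B)" for A :: "real^'n^'m"
  by (simp add: matrix_matrix_mult_def vec_eq_iff sum_negf)

lemma matrix_zero_left: "0 ** B = 0" for B :: "real^'n^'m"
  by (simp add: matrix_matrix_mult_def vec_eq_iff)

lemma matrix_zero_right: "B ** 0 = 0" for B :: "real^'n^'m"
  by (simp add: matrix_matrix_mult_def vec_eq_iff)

lemmas matrix_ring_simps = matrix_add_ldistrib matrix_add_rdistrib matrix_sub_ldistrib
  matrix_sub_rdistrib matrix_scaleR_left matrix_scaleR_right matrix_minus_left matrix_minus_right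
  matrix_zero_left matrix_zero_right

lemma transpose_add: "transpose (A + B) = transpose A + transpose B"
  by (simp add: transpose_def vec_eq_iff)

lemma transpose_diff: "transpose (A - B) = transpose A - transpose B"
  by (simp add: transpose_def vec_eq_iff)

lemma matrix_vector_minus: "(- A) *v x = - (A *v x)" for A :: "real^'n^'m"
  by (simp add: matrix_vector_mult_def vec_eq_iff sum_negf)

lemma bounded_bilinear_matrix_mult:
  "bounded_bilinear ((**) :: real^'n^'m \<Rightarrow> real^'k^'n \<Rightarrow> real^'k^'m)"
  unfolding bilinear_conv_bounded_bilinear[symmetric] bilinear_def
  by (auto intro!: linearI simp: matrix_ring_simps)

lemma bounded_linear_transpose: "bounded_linear (transpose :: real^'n^'m \<Rightarrow> real^'m^'n)"
  unfolding linear_conv_bounded_linear[symmetric]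
  by (auto intro!: linearI simp: transpose_def vec_eq_iff)

lemma bounded_linear_mult_vector: "bounded_linear (\<lambda>M :: real^'n^'m. M *v v)"
  unfolding linear_conv_bounded_linear[symmetric]
  by (auto intro!: linearI simp: matrix_vector_mult_def vec_eq_iff sum.distrib sum_distrib_left algebra_simps)

lemma bounded_linear_form: "bounded_linear (\<lambda>M :: real^'n^'m. u \<bullet> (M *v v))"
  by (rule bounded_linear_compose[OF bounded_linear_inner_right bounded_linear_mult_vector])

lemma inner_transpose: "u \<bullet> (transpose A *v v) = (A *v u) \<bullet> v" for A :: "real^'n^'m"
  by (simp add: dot_lmul_matrix inner_commute[of u] inner_commute[of v])

lemma matrix_inv_mult:
  assumes "invertible A"
  shows "A ** matrix_inv A = mat 1" "matrix_inv A ** A = mat 1"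
  using someI_ex[OF assms[unfolded invertible_def]] unfolding matrix_inv_def by auto

lemma linear_axis_expansion:
  fixes f :: "real^'n \<Rightarrow> 'b::real_vector"
  assumes "linear f"
  shows "f w = (\<Sum>i\<in>UNIV. w $ i *\<^sub>R f (axis i 1))"
proof -
  have "f w = f (\<Sum>i\<in>UNIV. w $ i *\<^sub>R axis i 1)"
    using basis_expansion[of w] by (simp add: scalar_mult_eq_scaleR)
  then show ?thesis by (simp only: linear_sum[OF assms] linear_scale[OF assms])
qed

lemma fd_bounded_linear:
  assumes "bounded_linear l" "f differentiable (at x)"
  shows "fd (\<lambda>y. l (f y)) x v = l (fd f x v)"
  using fd_unique[OF bounded_linear.has_derivative[OF assms(1)], of f "fd f x" x]
    assms(2) frechet_derivative_works by metis

lemma fd_transfer: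
  assumes "open S" "x \<in> S" "f differentiable (at x)" "\<And>y. y \<in> S \<Longrightarrow> f y = g y"
  shows "fd f x = fd g x"
  using frechet_derivative_transform_within_open[OF assms(3,1,2,4)] by simp

lemma fd_matrix_mult:
  fixes A :: "'a::euclidean_space \<Rightarrow> real^'n^'m"
  assumes "A differentiable (at x)" "B differentiable (at x)"
  shows "fd (\<lambda>y. A y ** B y) x v = A x ** fd B x v + fd A x v ** B x"
  using fd_unique[OF bounded_bilinear.FDERIV[OF bounded_bilinear_matrix_mult
    assms[unfolded frechet_derivative_works]]] by simp

lemma differentiable_matrix_mult:
  fixes A :: "'a::euclidean_space \<Rightarrow> real^'n^'m"
  assumes "A differentiable (at x)" "B differentiable (at x)"
  shows "(\<lambda>y. A y ** B y) differentiable (at x)"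
  using bounded_bilinear.FDERIV[OF bounded_bilinear_matrix_mult
    assms[unfolded frechet_derivative_works]] by (auto simp: differentiable_def)

lemma fd_add:
  assumes "f differentiable (at x)" "g differentiable (at x)"
  shows "fd (\<lambda>y. f y + g y) x v = fd f x v + fd g x v"
  using fd_unique[OF has_derivative_add[OF assms[unfolded frechet_derivative_works]]] by simp

lemma fd_diff:
  assumes "f differentiable (at x)" "g differentiable (at x)"
  shows "fd (\<lambda>y. f y - g y) x v = fd f x v - fd g x v"
  using fd_unique[OF has_derivative_diff[OF assms[unfolded frechet_derivative_works]]] by simp

lemma pd_nth:
  fixes T :: "real^'n \<Rightarrow> real^'k^'m"
  assumes "T differentiable (at x)"
  shows "pd i (\<lambda>y. T y $ a $ b) x = fd T x (axis i 1) $ a $ b"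
  unfolding pd_def
  by (rule fd_bounded_linear[OF bounded_linear_compose[OF bounded_linear_vec_nth bounded_linear_vec_nth] assms, unfolded o_def])

lemma Ck_on_det:
  fixes A :: "'a::euclidean_space \<Rightarrow> real^'n^'n"
  assumes "open S" "\<And>i j. Ck_on k S (\<lambda>x. A x $ i $ j)"
  shows "Ck_on k S (\<lambda>x. det (A x))"
  unfolding det_def
  by (intro Ck_on_sum Ck_on_mult Ck_on_prod Ck_on_const assms)

text \<open>By Cramer's rule each entry of the inverse is a quotient of determinants, hence of
  polynomials in the entries of \<open>A\<close>.\<close>

lemma Ck_on_matrix_inv:
  fixes A :: "'a::euclidean_space \<Rightarrow> real^'n^'n"
  assumes "open S" "Ck_on k S A" "\<And>x. x \<in> S \<Longrightarrow> invertible (A x)"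
  shows "Ck_on k S (\<lambda>x. matrix_inv (A x))"
proof (intro Ck_on_vec assms(1))
  fix i j
  define M where "M x = (\<chi> p q. if q = i then axis j 1 $ p else A x $ p $ q)" for x
  have A: "Ck_on k S (\<lambda>x. A x $ p $ q)" for p q
    by (intro Ck_on_nth assms(1,2))
  have M: "Ck_on k S (\<lambda>x. M x $ p $ q)" for p q
    by (cases "q = i") (simp_all add: M_def Ck_on_const A)
  have "matrix_inv (A x) $ i $ j = det (M x) * inverse (det (A x))" if "x \<in> S" for x
  proof -
    have d: "det (A x) \<noteq> 0" using assms(3)[OF that] invertible_det_nz by blast
    have "A x *v (matrix_inv (A x) *v axis j 1) = axis j 1"
      using matrix_inv_mult(1)[OF assms(3)[OF that]] by (simp add: matrix_vector_mul_assoc)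
    from iffD1[OF cramer[OF d] this]
    have "(matrix_inv (A x) *v axis j 1) $ i = det (M x) / det (A x)"
      unfolding M_def by simp
    then show ?thesis by (simp add: matrix_vector_mult_basis column_def divide_inverse)
  qed
  moreover have "Ck_on k S (\<lambda>x. det (M x) * inverse (det (A x)))"
    using assms(3) by (intro Ck_on_mult Ck_on_inverse Ck_on_det assms(1) M A) (auto simp: invertible_det_nz)
  ultimately show "Ck_on k S (\<lambda>x. matrix_inv (A x) $ i $ j)"
    using Ck_on_cong[OF assms(1)] by (metis (no_types, lifting))
qed

section \<open>Local Riemannian geometry\<close>

lemma Ck_on_2D:
  assumes "Ck_on 2 S f"
  shows "x \<in> S \<Longrightarrow> f differentiable (at x)" "Ck_on 1 S (\<lambda>x. fd f x v)" "Ck_on 1 S f"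
    "x \<in> S \<Longrightarrow> linear (fd f x)"
  using assms Ck_on_le[OF assms, of 1] linear_frechet_derivative by (auto simp: numeral_2_eq_2)

lemma Ck_on_1D: "Ck_on 1 S f \<Longrightarrow> x \<in> S \<Longrightarrow> f differentiable (at x)"
  by simp

lemma bilinear_axis_expansion:
  fixes f :: "real^'n \<Rightarrow> real^'m \<Rightarrow> real"
  assumes "\<And>v. linear (\<lambda>u. f u v)" "\<And>u. linear (f u)"
  shows "f u v = (\<Sum>i\<in>UNIV. u $ i *\<^sub>R (\<Sum>j\<in>UNIV. v $ j *\<^sub>R f (axis i 1) (axis j 1)))"
  by (subst linear_axis_expansion[OF assms(1)], subst linear_axis_expansion[OF assms(2)]) simp

text \<open>The geometric notions are defined by indices. This lemma and the next carry identities
  from coordinate vectors to arbitrary ones.\<close>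

lemma bilinear_axis_eq:
  fixes f g :: "real^'n \<Rightarrow> real^'m \<Rightarrow> real"
  assumes "\<And>v. linear (\<lambda>u. f u v)" "\<And>u. linear (f u)" "\<And>v. linear (\<lambda>u. g u v)" "\<And>u. linear (g u)"
    and "\<And>i j. f (axis i 1) (axis j 1) = g (axis i 1) (axis j 1)"
  shows "f u v = g u v"
  by (rule trans[OF bilinear_axis_expansion[of f, OF assms(1,2)]])
    (simp only: assms(5) bilinear_axis_expansion[of g u v, OF assms(3,4), symmetric])

lemma trilinear_axis_eq:
  fixes f g :: "real^'n \<Rightarrow> real^'m \<Rightarrow> real^'k \<Rightarrow> real"
  assumes f: "\<And>v w. linear (\<lambda>u. f u v w)" "\<And>u w. linear (\<lambda>v. f u v w)" "\<And>u v. linear (f u v)"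
    and g: "\<And>v w. linear (\<lambda>u. g u v w)" "\<And>u w. linear (\<lambda>v. g u v w)" "\<And>u v. linear (g u v)"
    and e: "\<And>i j k. f (axis i 1) (axis j 1) (axis k 1) = g (axis i 1) (axis j 1) (axis k 1)"
  shows "f u v w = g u v w"
proof -
  have "f (axis i 1) v w = g (axis i 1) v w" for i
    by (rule bilinear_axis_eq[of "f (axis i 1)" "g (axis i 1)", OF f(2,3) g(2,3) e])
  then show ?thesis
    by (subst linear_axis_expansion[OF f(1)], subst linear_axis_expansion[OF g(1)]) simp
qed

text \<open>A trace for maps given as functions: Ricci traces run over the first argument of the
  curvature, a slot in which it is not given as a matrix.\<close>

definition tr :: "(real^'n \<Rightarrow> real^'n) \<Rightarrow> real" where
  "tr f = (\<Sum>i\<in>UNIV. f (axis i 1) $ i)"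

lemma tr_matrix: "tr ((*v) M) = trace M"
  by (simp add: tr_def trace_def matrix_vector_mult_basis column_def)

lemma tr_minus: "tr (\<lambda>z. - f z) = - tr f"
  by (simp add: tr_def sum_negf)

lemma tr_comm:
  assumes "linear f"
  shows "tr (\<lambda>z. f (A *v z)) = tr (\<lambda>z. A *v f z)"
proof -
  have f: "f z = matrix f *v z" for z using assms by simp
  have "tr (\<lambda>z. f (A *v z)) = trace (matrix f ** A)"
    unfolding tr_matrix[symmetric] by (subst f) (simp add: matrix_vector_mul_assoc)
  also have "\<dots> = trace (A ** matrix f)" by (rule trace_mul_sym)
  also have "\<dots> = tr (\<lambda>z. A *v f z)"
    unfolding tr_matrix[symmetric] by (subst f) (simp add: matrix_vector_mul_assoc)
  finally show ?thesis .
qed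

text \<open>\<open>gam G x w\<close> is the matrix of \<open>v \<mapsto> \<Gamma>(w, v)\<close>, so that \<open>\<nabla>\<^sub>w\<close> is \<open>\<partial>\<^sub>w + gam G x w\<close> on vector fields;
  \<open>cov G T x w\<close> is \<open>\<nabla>\<^sub>w T\<close> for an endomorphism \<open>T\<close>, and \<open>curv G x u v *v w\<close> is \<open>R(u, v)w\<close>.\<close>

definition gam :: "(real^'n \<Rightarrow> real^'n^'n) \<Rightarrow> real^'n \<Rightarrow> real^'n \<Rightarrow> real^'n^'n" where
  "gam G x w = (\<Sum>i\<in>UNIV. w $ i *\<^sub>R (\<chi> k j. christoffel G x k i j))"

definition cov :: "(real^'n \<Rightarrow> real^'n^'n) \<Rightarrow> (real^'n \<Rightarrow> real^'n^'n) \<Rightarrow> real^'n \<Rightarrow> real^'n \<Rightarrow> real^'n^'n" where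
  "cov G T x w = fd T x w + gam G x w ** T x - T x ** gam G x w"

definition curv :: "(real^'n \<Rightarrow> real^'n^'n) \<Rightarrow> real^'n \<Rightarrow> real^'n \<Rightarrow> real^'n \<Rightarrow> real^'n^'n" where
  "curv G x u v = fd (\<lambda>y. gam G y v) x u - fd (\<lambda>y. gam G y u) x v
     + gam G x u ** gam G x v - gam G x v ** gam G x u"

lemma linear_gam: "linear (gam G x)"
  unfolding gam_def
  by (auto intro!: linearI simp: scaleR_add_left sum.distrib scaleR_sum_right)

lemmas gam_add = linear_add[OF linear_gam]
lemmas gam_scale = linear_scale[OF linear_gam]

lemma sum_axis_scaleR:
  fixes M :: "'n::finite \<Rightarrow> 'b::real_vector"
  shows "(\<Sum>j\<in>UNIV. axis i 1 $ j *\<^sub>R M j) = M i"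
proof -
  have "(\<Sum>j\<in>UNIV. axis i 1 $ j *\<^sub>R M j) = (\<Sum>j\<in>UNIV. if j = i then M j else 0)"
    by (intro sum.cong) (simp_all add: axis_def)
  then show ?thesis by simp
qed

lemma gam_axis: "gam G x (axis i 1) = (\<chi> k j. christoffel G x k i j)"
  unfolding gam_def sum_axis_scaleR ..

text \<open>Two derivatives of the metric are what curvature consumes: the Christoffel symbols are
  then of class one.\<close>

locale metric_chart =
  fixes U :: "(real^'n) set" and G :: "real^'n \<Rightarrow> real^'n^'n"
  assumes open_U: "open U" and G_C2: "Ck_on 2 U G"
    and G_transpose: "x \<in> U \<Longrightarrow> transpose (G x) = G x"
    and G_pos: "x \<in> U \<Longrightarrow> u \<noteq> 0 \<Longrightarrow> u \<bullet> (G x *v u) > 0"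
begin

lemma G_sym: "x \<in> U \<Longrightarrow> u \<bullet> (G x *v v) = v \<bullet> (G x *v u)"
  using inner_transpose[of u "G x" v] G_transpose by (simp add: inner_commute)

lemma G_inj: 
  assumes "x \<in> U" "\<And>u. u \<bullet> (G x *v a) = u \<bullet> (G x *v b)"
  shows "a = b"
proof (rule ccontr)
  assume "a \<noteq> b"
  then have "(a - b) \<bullet> (G x *v (a - b)) > 0" using G_pos[OF assms(1)] by simp
  then show False using assms(2)[of "a - b"] by (simp add: matrix_vector_mult_diff_distrib inner_diff_right)
qed

lemma invertible_G: "x \<in> U \<Longrightarrow> invertible (G x)"
  unfolding invertible_left_inverse matrix_left_invertible_injective
  using G_inj by (metis (no_types, lifting) injI)

lemmas G_inv = matrix_inv_mult[OF invertible_G]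

lemma G_inv_C2: "Ck_on 2 U (\<lambda>x. matrix_inv (G x))"
  by (rule Ck_on_matrix_inv[OF open_U G_C2 invertible_G])

lemma dG_sym:
  assumes "x \<in> U" shows "u \<bullet> (fd G x w *v v) = v \<bullet> (fd G x w *v u)"
proof -
  have d: "G differentiable (at x)" using Ck_on_2D(1)[OF G_C2 assms] .
  have "fd (\<lambda>y. transpose (G y)) x = fd G x"
    by (rule fd_transfer[OF open_U assms, symmetric]) (auto simp: G_transpose d)
  then have "transpose (fd G x w) = fd G x w"
    using fd_bounded_linear[OF bounded_linear_transpose d] by metis
  then show ?thesis using inner_transpose[of u "fd G x w" v] by (simp add: inner_commute)
qed

lemma linear_dG: "x \<in> U \<Longrightarrow> linear (fd G x)"
  using Ck_on_2D(4)[OF G_C2] .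

lemma christoffel_eq:
  assumes "x \<in> U"
  shows "christoffel G x k i j = 1 / 2 * (\<Sum>l\<in>UNIV. matrix_inv (G x) $ k $ l *
     (fd G x (axis i 1) $ j $ l + fd G x (axis j 1) $ i $ l - fd G x (axis l 1) $ i $ j))"
  unfolding christoffel_def pd_nth[OF Ck_on_2D(1)[OF G_C2 assms]] ..

lemma christoffel_lower:
  assumes "x \<in> U"
  shows "(\<Sum>k\<in>UNIV. G x $ l $ k * christoffel G x k i j) =
    1 / 2 * (fd G x (axis i 1) $ j $ l + fd G x (axis j 1) $ i $ l - fd G x (axis l 1) $ i $ j)"
proof -
  define c where "c = (\<chi> l. fd G x (axis i 1) $ j $ l + fd G x (axis j 1) $ i $ l - fd G x (axis l 1) $ i $ j)"
  have "(\<chi> k. christoffel G x k i j) = (1 / 2) *\<^sub>R (matrix_inv (G x) *v c)"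
    unfolding christoffel_eq[OF assms] c_def by (simp add: matrix_vector_mult_def vec_eq_iff)
  then have "G x *v (\<chi> k. christoffel G x k i j) = (1 / 2) *\<^sub>R c"
    using G_inv(1)[OF assms] by (simp add: matrix_vector_mult_scaleR matrix_vector_mul_assoc)
  then have "(G x *v (\<chi> k. christoffel G x k i j)) $ l = ((1 / 2) *\<^sub>R c) $ l" by simp
  then show ?thesis by (simp add: c_def matrix_vector_mult_def)
qed

text \<open>The Koszul formula for constant vector fields, whose brackets vanish. On coordinate
  vectors it is the definition of the Christoffel symbols with the upper index lowered.\<close>

lemma gam_lower:
  assumes "x \<in> U"
  shows "u \<bullet> (G x *v (gam G x w *v v)) =
    1 / 2 * (v \<bullet> (fd G x w *v u) + w \<bullet> (fd G x v *v u) - w \<bullet> (fd G x u *v v))"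
proof -
  note lin = linear_add[OF linear_dG[OF assms]] linear_scale[OF linear_dG[OF assms]]
  show ?thesis
  proof (rule trilinear_axis_eq[where f = "\<lambda>u w v. u \<bullet> (G x *v (gam G x w *v v))" and
      g = "\<lambda>u w v. 1 / 2 * (v \<bullet> (fd G x w *v u) + w \<bullet> (fd G x v *v u) - w \<bullet> (fd G x u *v v))"])
    fix l i j
    have "axis l 1 \<bullet> (G x *v (gam G x (axis i 1) *v axis j 1)) = (\<Sum>k\<in>UNIV. G x $ l $ k * christoffel G x k i j)"
    proof -
      have "gam G x (axis i 1) *v axis j 1 = (\<chi> k. christoffel G x k i j)"
        by (simp add: gam_axis matrix_vector_mult_basis column_def)
      then show ?thesis by (simp add: inner_axis' matrix_vector_mult_def)
    qed
    also have "\<dots> = 1 / 2 * (axis j 1 \<bullet> (fd G x (axis i 1) *v axis l 1) + axis i 1 \<bullet> (fd G x (axis j 1) *v axis l 1)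
          - axis i 1 \<bullet> (fd G x (axis l 1) *v axis j 1))"
      unfolding christoffel_lower[OF assms] by (simp add: inner_axis' matrix_vector_mult_basis column_def)
    finally show "axis l 1 \<bullet> (G x *v (gam G x (axis i 1) *v axis j 1)) = 1 / 2 * (axis j 1 \<bullet> (fd G x (axis i 1) *v axis l 1) + axis i 1 \<bullet> (fd G x (axis j 1) *v axis l 1)
          - axis i 1 \<bullet> (fd G x (axis l 1) *v axis j 1))" .
  qed (auto intro!: linearI simp: gam_add gam_scale lin algebra_simps add_divide_distrib inner_add_left inner_add_right
      matrix_vector_mult_scaleR scaleR_matrix_vector_assoc[symmetric])
qed

text \<open>Torsion-freeness of the connection.\<close>

lemma gam_sym:
  assumes "x \<in> U" shows "gam G x w *v v = gam G x v *v w"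
proof (rule G_inj[OF assms])
  fix u show "u \<bullet> (G x *v (gam G x w *v v)) = u \<bullet> (G x *v (gam G x v *v w))"
    unfolding gam_lower[OF assms] using dG_sym[OF assms, of w u v] by simp
qed

text \<open>The metric is parallel: in the sum of the Koszul formulas for \<open>(u, v)\<close> and
  \<open>(v, u)\<close> only the derivative along \<open>w\<close> survives.\<close>

lemma metric_compatible:
  assumes "x \<in> U"
  shows "fd G x w = G x ** gam G x w + transpose (gam G x w) ** G x"
proof -
  have "u \<bullet> (fd G x w *v v) = u \<bullet> (G x *v (gam G x w *v v)) + (gam G x w *v u) \<bullet> (G x *v v)" for u v
    unfolding G_sym[OF assms, of "gam G x w *v u"] gam_lower[OF assms]
    using dG_sym[OF assms, of u w v] by (simp add: field_simps)
  then have "u \<bullet> (fd G x w *v v) = u \<bullet> ((G x ** gam G x w + transpose (gam G x w) ** G x) *v v)" for u v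
    by (simp add: matrix_vector_mult_add_rdistrib matrix_vector_mul_assoc[symmetric] inner_add_right
        inner_transpose del: transpose_matrix_vector)
  then show ?thesis unfolding matrix_eq by (metis vector_eq_ldot)
qed

lemma gam_C1: "Ck_on 1 U (\<lambda>x. gam G x w)"
  unfolding gam_def
proof (intro Ck_on_sum Ck_on_scaleR Ck_on_const open_U)
  fix i
  show "Ck_on 1 U (\<lambda>x. \<chi> k j. christoffel G x k i j)"
  proof (intro Ck_on_vec open_U)
    fix k j
    have "Ck_on 1 U (\<lambda>x. 1 / 2 * (\<Sum>l\<in>UNIV. matrix_inv (G x) $ k $ l *
     (fd G x (axis i 1) $ j $ l + fd G x (axis j 1) $ i $ l - fd G x (axis l 1) $ i $ j)))"
      by (intro Ck_on_mult Ck_on_const Ck_on_sum Ck_on_add Ck_on_diff Ck_on_nth open_U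
          Ck_on_2D(3)[OF G_inv_C2] Ck_on_2D(2)[OF G_C2])
    then have "Ck_on 1 U (\<lambda>x. christoffel G x k i j)"
      by (rule Ck_on_cong[OF open_U, rotated]) (simp only: christoffel_eq)
    then show "Ck_on 1 U (\<lambda>x. (\<chi> k j. christoffel G x k i j) $ k $ j)" by simp
  qed
qed

lemma gam_diff: "x \<in> U \<Longrightarrow> (\<lambda>y. gam G y w) differentiable (at x)"
  by (rule Ck_on_1D[OF gam_C1])

lemma dgam_add: "x \<in> U \<Longrightarrow> fd (\<lambda>y. gam G y (a + b)) x u = fd (\<lambda>y. gam G y a) x u + fd (\<lambda>y. gam G y b) x u"
  unfolding gam_add by (rule fd_add[OF gam_diff gam_diff])

lemma dgam_scale: "x \<in> U \<Longrightarrow> fd (\<lambda>y. gam G y (c *\<^sub>R b)) x u = c *\<^sub>R fd (\<lambda>y. gam G y b) x u"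
  unfolding gam_scale by (rule fd_bounded_linear[OF bounded_linear_scaleR_right gam_diff])

lemma curv_antisym: "curv G x u v = - curv G x v u"
  by (simp add: curv_def)

lemma linear_curv1: "x \<in> U \<Longrightarrow> linear (\<lambda>u. curv G x u v)"
  using linear_frechet_derivative[OF gam_diff]
  by (auto intro!: linearI simp: curv_def dgam_add[unfolded gam_add] dgam_scale[unfolded gam_scale] gam_add gam_scale linear_add linear_scale
      matrix_ring_simps algebra_simps)

lemma linear_curv2: "x \<in> U \<Longrightarrow> linear (curv G x u)"
proof -
  assume "x \<in> U"
  then have "linear (\<lambda>v. - curv G x v u)" by (rule linear_compose_neg[OF linear_curv1])
  moreover have "curv G x u = (\<lambda>v. - curv G x v u)" by (rule ext) (rule curv_antisym)
  ultimately show ?thesis by (rule ssubst[rotated])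
qed

lemmas curv_add2 = linear_add[OF linear_curv2]
lemmas curv_scale2 = linear_scale[OF linear_curv2]

lemma riemann_curv:
  assumes "x \<in> U"
  shows "riemann G x l k i j = curv G x (axis i 1) (axis j 1) $ l $ k"
proof -
  have "pd i (\<lambda>y. christoffel G y l j k) x = fd (\<lambda>y. gam G y (axis j 1)) x (axis i 1) $ l $ k" for i j
    using pd_nth[OF gam_diff[OF assms], of i "axis j 1" l k] by (simp add: gam_axis)
  then show ?thesis
    by (simp add: riemann_def curv_def gam_axis matrix_matrix_mult_def)
qed

lemma ricci_tr:
  assumes "x \<in> U"
  shows "u \<bullet> (ricci G x *v v) = tr (\<lambda>z. curv G x z u *v v)"
proof -
  show ?thesis
    by (rule bilinear_axis_eq[where f = "\<lambda>u v. u \<bullet> (ricci G x *v v)" and g = "\<lambda>u v. tr (\<lambda>z. curv G x z u *v v)"])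
      (auto intro!: linearI simp: tr_def curv_add2[OF assms] curv_scale2[OF assms] algebra_simps inner_add_left
        inner_add_right sum.distrib sum_distrib_left matrix_vector_mult_scaleR scaleR_matrix_vector_assoc[symmetric] 
        inner_axis' matrix_vector_mult_basis column_def ricci_def riemann_curv[OF assms])
qed

end

section \<open>Symmetries of the curvature tensor\<close>

lemma pair_symmetry:
  fixes r :: "'a \<Rightarrow> 'a \<Rightarrow> 'a \<Rightarrow> 'a \<Rightarrow> real"
  assumes 1: "\<And>a b c d. r b a c d = - r a b c d" and 2: "\<And>a b c d. r a b d c = - r a b c d"
    and B: "\<And>a b c d. r a b c d + r b c a d + r c a b d = 0"
  shows "r a b c d = r c d a b"
proof -
  \<comment> \<open>Rewritten with the two antisymmetries, the four Bianchi identities for the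
    rotations of \<open>a b c d\<close> combine linearly to the claim.\<close>
  have "r b c d a = - r b c a d" "r c d b a = - r c d a b" "r d b c a = r b d a c"
    "r d a c b = - r d a b c" "r a c d b = r c a b d" "r a b d c = - r a b c d"
    using 1 2 by (metis add.inverse_inverse)+
  then show ?thesis
    using B[of a b c d] B[of b c d a] B[of c d a b] B[of d a b c] by linarith
qed

lemma trace_minus: "trace (- A) = - trace A" for A :: "real^'n^'n"
  by (simp add: trace_def sum_negf)

context metric_chart
begin

lemma cov_derivative:
  assumes "x \<in> U" "Ck_on 2 U T"
  shows "fd (\<lambda>y. cov G T y v) x u = fd (\<lambda>y. fd T y v) x u
    + (gam G x v ** fd T x u + fd (\<lambda>y. gam G y v) x u ** T x)
    - (T x ** fd (\<lambda>y. gam G y v) x u + fd T x u ** gam G x v)"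
proof -
  have T: "T differentiable (at x)" "(\<lambda>y. fd T y v) differentiable (at x)"
    using Ck_on_2D(1)[OF assms(2,1)] Ck_on_1D[OF Ck_on_2D(2)[OF assms(2)] assms(1)] by auto
  note d = T gam_diff[OF assms(1)] differentiable_matrix_mult[OF T(1) gam_diff[OF assms(1)]]
    differentiable_matrix_mult[OF gam_diff[OF assms(1)] T(1)]
  show ?thesis
    unfolding cov_def by (simp only: fd_diff fd_add fd_matrix_mult differentiable_add d)
qed

text \<open>The inner direction is a constant vector, so the right-hand side is a commutator of
  covariant derivatives along commuting fields and needs no bracket term. The second partial
  derivatives of \<open>T\<close> cancel, and what remains of the Christoffel terms is the
  curvature.\<close>

lemma ricci_identity:
  assumes "x \<in> U" "Ck_on 2 U T"
  shows "curv G x u v ** T x - T x ** curv G x u v =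
    cov G (\<lambda>y. cov G T y v) x u - cov G (\<lambda>y. cov G T y u) x v"
  unfolding cov_def[of G "\<lambda>y. cov G T y v"] cov_def[of G "\<lambda>y. cov G T y u"] cov_derivative[OF assms]
    second_derivative_symmetric[OF open_U assms(2,1), of u v]
  by (simp add: cov_def curv_def matrix_ring_simps matrix_mul_assoc algebra_simps)

lemma curv_commute:
  assumes "x \<in> U" "Ck_on 2 U T" "\<And>y v. y \<in> U \<Longrightarrow> cov G T y v = 0"
  shows "curv G x u v ** T x = T x ** curv G x u v"
proof -
  have "fd (\<lambda>y. cov G T y v) x u = 0" for u v
  proof -
    have "fd (\<lambda>y. 0) x = fd (\<lambda>y. cov G T y v) x"
      by (rule fd_transfer[OF open_U assms(1)]) (auto simp: assms(3))
    then show ?thesis by (metis frechet_derivative_const)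
  qed
  then have "cov G (\<lambda>y. cov G T y v) x u = 0" for u v
    unfolding cov_def[of G "\<lambda>y. cov G T y v"] by (simp add: assms(1,3) matrix_ring_simps)
  then show ?thesis using ricci_identity[OF assms(1,2), of u v] by simp
qed

text \<open>This is the symmetry of the second derivatives of \<open>G\<close>, each of them
  expanded by differentiating \<open>metric_compatible\<close>.\<close>

lemma curv_skew:
  assumes "x \<in> U"
  shows "G x ** curv G x u v + transpose (curv G x u v) ** G x = 0"
proof -
  have G: "G differentiable (at x)" using Ck_on_2D(1)[OF G_C2 assms] .
  have t: "(\<lambda>y. transpose (gam G y v)) differentiable (at x)" for v
    using bounded_linear.has_derivative[OF bounded_linear_transpose gam_diff[OF assms, unfolded frechet_derivative_works]]
    by (auto simp: differentiable_def)
  have "fd (\<lambda>y. fd G y v) x u = G x ** fd (\<lambda>y. gam G y v) x u + fd G x u ** gam G x v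
      + (transpose (gam G x v) ** fd G x u + transpose (fd (\<lambda>y. gam G y v) x u) ** G x)" for u v
  proof -
    have "fd (\<lambda>y. fd G y v) x = fd (\<lambda>y. G y ** gam G y v + transpose (gam G y v) ** G y) x"
      by (rule fd_transfer[OF open_U assms]) 
        (use Ck_on_1D[OF Ck_on_2D(2)[OF G_C2] assms] metric_compatible in auto)
    then show ?thesis
      by (simp only: fd_add fd_matrix_mult differentiable_matrix_mult G t gam_diff[OF assms]
          fd_bounded_linear[OF bounded_linear_transpose])
  qed
  then show ?thesis
    using second_derivative_symmetric[OF open_U G_C2 assms, of u v]
    by (simp add: metric_compatible[OF assms] curv_def matrix_ring_simps matrix_mul_assoc transpose_add
      transpose_diff matrix_transpose_mul algebra_simps)
qed

lemma curv_skew_vec: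
  assumes "x \<in> U"
  shows "c \<bullet> (G x *v (curv G x a b *v d)) = - (d \<bullet> (G x *v (curv G x a b *v c)))"
proof -
  have "c \<bullet> ((G x ** curv G x a b + transpose (curv G x a b) ** G x) *v d) = 0"
    by (simp add: curv_skew[OF assms])
  then show ?thesis
    by (simp add: matrix_vector_mult_add_rdistrib matrix_vector_mul_assoc[symmetric] inner_add_right
      inner_transpose G_sym[OF assms, of "curv G x a b *v c" d] del: transpose_matrix_vector)
qed

text \<open>\<open>gam G y v *v w\<close> is symmetric in \<open>v\<close> and \<open>w\<close>, and
  so are its derivatives; the cyclic sum therefore cancels in pairs, both in its derivative terms
  and in its quadratic terms.\<close>

lemma bianchi:
  assumes "x \<in> U"
  shows "curv G x u v *v w + curv G x v w *v u + curv G x w u *v v = 0"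
proof -
  have "fd (\<lambda>y. gam G y v) x u *v w = fd (\<lambda>y. gam G y w) x u *v v" for u v w
  proof -
    have "(\<lambda>y. gam G y v *v w) differentiable (at x)"
      using bounded_linear.has_derivative[OF bounded_linear_mult_vector gam_diff[OF assms, unfolded frechet_derivative_works]]
      by (auto simp: differentiable_def)
    then have "fd (\<lambda>y. gam G y v *v w) x = fd (\<lambda>y. gam G y w *v v) x"
      by (rule fd_transfer[OF open_U assms]) (rule gam_sym)
    then show ?thesis
      by (metis fd_bounded_linear[OF bounded_linear_mult_vector gam_diff[OF assms]])
  qed
  from this[of v u w] this[of w v u] this[of u w v] show ?thesis
    unfolding curv_def
    by (simp add: matrix_vector_mult_add_rdistrib matrix_vector_mult_diff_rdistrib matrix_vector_mul_assoc[symmetric]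
      gam_sym[OF assms, of v u] gam_sym[OF assms, of w u] gam_sym[OF assms, of w v])
qed

lemma curv_pair:
  assumes "x \<in> U"
  shows "d \<bullet> (G x *v (curv G x a b *v c)) = b \<bullet> (G x *v (curv G x c d *v a))"
proof (rule pair_symmetry[where r = "\<lambda>a b c d. d \<bullet> (G x *v (curv G x a b *v c))"])
  fix a b c d
  show "d \<bullet> (G x *v (curv G x b a *v c)) = - (d \<bullet> (G x *v (curv G x a b *v c)))"
    by (subst curv_antisym) (simp add: matrix_vector_minus vec.neg)
  show "c \<bullet> (G x *v (curv G x a b *v d)) = - (d \<bullet> (G x *v (curv G x a b *v c)))"
    by (rule curv_skew_vec[OF assms])
  have "d \<bullet> (G x *v (curv G x a b *v c + curv G x b c *v a + curv G x c a *v b)) = 0"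
    by (simp add: bianchi[OF assms])
  then show "d \<bullet> (G x *v (curv G x a b *v c)) + d \<bullet> (G x *v (curv G x b c *v a)) + d \<bullet> (G x *v (curv G x c a *v b)) = 0"
    by (simp add: matrix_vector_right_distrib inner_add_right)
qed

lemma linear_curv_vec: "x \<in> U \<Longrightarrow> linear (\<lambda>z. curv G x z v *v w)"
  using linear_compose[OF linear_curv1 bounded_linear.linear[OF bounded_linear_mult_vector]] by (simp add: o_def)

text \<open>An endomorphism that is skew for the metric is conjugate, through \<open>G\<close>, to
  minus its transpose.\<close>

lemma trace_curv:
  assumes "x \<in> U" shows "trace (curv G x u v) = 0"
proof -
  let ?R = "curv G x u v"
  have "matrix_inv (G x) ** (G x ** ?R) = - (matrix_inv (G x) ** (transpose ?R ** G x))"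
    using curv_skew[OF assms, of u v] by (simp add: eq_neg_iff_add_eq_0 matrix_add_ldistrib[symmetric] matrix_zero_right)
  then have "?R = - (matrix_inv (G x) ** (transpose ?R ** G x))"
    by (simp add: matrix_mul_assoc G_inv[OF assms])
  then have "trace ?R = - trace (matrix_inv (G x) ** (transpose ?R ** G x))"
    by (metis trace_minus)
  also have "trace (matrix_inv (G x) ** (transpose ?R ** G x)) = trace ?R"
    by (subst trace_mul_sym) (simp add: matrix_mul_assoc[symmetric] G_inv[OF assms], simp add: trace_def transpose_def)
  finally show ?thesis by simp
qed

text \<open>The Bianchi identity expresses \<open>R(u, v)w\<close> by curvatures with
  \<open>w\<close> in the first slot, which is the slot of Ricci traces. The identity matrix for
  \<open>A\<close> gives the symmetry of Ricci, and \<open>I\<close> gives the Ricci form.\<close>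

lemma tr_curv_swap:
  assumes "x \<in> U"
  shows "tr (\<lambda>z. curv G x u v *v (A *v z)) =
    tr (\<lambda>z. curv G x (A *v z) v *v u) - tr (\<lambda>z. curv G x (A *v z) u *v v)"
proof -
  have "curv G x u v *v w = curv G x w v *v u - curv G x w u *v v" for w
    using bianchi[OF assms, of u v w] curv_antisym[of x v w] 
    by (simp add: matrix_vector_minus algebra_simps eq_neg_iff_add_eq_0)
  then show ?thesis by (simp add: tr_def sum_subtractf)
qed

lemma ricci_sym:
  assumes "x \<in> U"
  shows "u \<bullet> (ricci G x *v v) = v \<bullet> (ricci G x *v u)"
proof -
  have "tr (\<lambda>z. curv G x u v *v z) = 0"
    using trace_curv[OF assms, of u v] tr_matrix[of "curv G x u v"] by simp
  then show ?thesis using tr_curv_swap[OF assms, of u v "mat 1"] by (simp add: ricci_tr[OF assms])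
qed

end


section \<open>Kaehler charts: invariance of the curvature and the Ricci form\<close>

locale kaehler_chart = metric_chart U G for U and G :: "real^'n \<Rightarrow> real^'n^'n" +
  fixes I :: "real^'n \<Rightarrow> real^'n^'n"
  assumes I_C2: "Ck_on 2 U I"
    and I_square: "x \<in> U \<Longrightarrow> I x ** I x = - mat 1"
    and I_isometry: "x \<in> U \<Longrightarrow> (I x *v u) \<bullet> (G x *v (I x *v v)) = u \<bullet> (G x *v v)"
    and I_parallel: "x \<in> U \<Longrightarrow> cov G I x u = 0"
begin

lemma I_I: "x \<in> U \<Longrightarrow> I x *v (I x *v v) = - v"
  by (simp add: matrix_vector_mul_assoc I_square matrix_vector_minus)

lemma I_skew: "x \<in> U \<Longrightarrow> (I x *v u) \<bullet> (G x *v v) = - (u \<bullet> (G x *v (I x *v v)))"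
  using I_isometry[of x "I x *v u" v] by (simp add: I_I)

lemma curv_I: "x \<in> U \<Longrightarrow> curv G x u v *v (I x *v w) = I x *v (curv G x u v *v w)"
  using curv_commute[OF _ I_C2 I_parallel] by (simp add: matrix_vector_mul_assoc)

text \<open>Pair symmetry exchanges the two arguments of the curvature with the slots of the
  endomorphism; there \<open>I\<close> commutes with the curvature and is an isometry.\<close>

lemma curv_I_I:
  assumes "x \<in> U"
  shows "curv G x (I x *v a) (I x *v b) = curv G x a b"
  unfolding matrix_eq
proof (rule allI, rule G_inj[OF assms])
  fix c d
  show "d \<bullet> (G x *v (curv G x (I x *v a) (I x *v b) *v c)) = d \<bullet> (G x *v (curv G x a b *v c))"
    unfolding curv_pair[OF assms, of d "I x *v a"] curv_pair[OF assms, of d a] curv_I[OF assms] I_isometry[OF assms] ..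
qed

lemma ricci_I:
  assumes "x \<in> U"
  shows "(I x *v u) \<bullet> (ricci G x *v (I x *v v)) = u \<bullet> (ricci G x *v v)"
proof -
  \<comment> \<open>\<open>I\<close> is taken out of the curvature endomorphism and moved by
    cyclicity into the argument \<open>z\<close>; now both arguments of the curvature carry an
    \<open>I\<close>.\<close>
  have "tr (\<lambda>z. curv G x z (I x *v u) *v (I x *v v)) = tr (\<lambda>z. curv G x (I x *v z) (I x *v u) *v v)"
    unfolding curv_I[OF assms] by (rule tr_comm[symmetric, OF linear_curv_vec[OF assms]])
  then show ?thesis unfolding ricci_tr[OF assms] curv_I_I[OF assms] .
qed

text \<open>The Bianchi identity splits the trace; both parts are Ricci traces because \<open>I\<close> commutes with
  the curvature and the trace is cyclic.\<close>

lemma ricci_form: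
  assumes "x \<in> U"
  shows "trace (curv G x u v ** I x) = 2 * ((I x *v u) \<bullet> (ricci G x *v v))"
proof -
  have "tr (\<lambda>z. curv G x (I x *v z) v *v u) = v \<bullet> (ricci G x *v (I x *v u))" for u v
    unfolding ricci_tr[OF assms] curv_I[OF assms] by (rule tr_comm[OF linear_curv_vec[OF assms]])
  then have "trace (curv G x u v ** I x) = v \<bullet> (ricci G x *v (I x *v u)) - u \<bullet> (ricci G x *v (I x *v v))"
    using tr_curv_swap[OF assms, of u v "I x"] by (simp add: tr_matrix[symmetric] matrix_vector_mul_assoc)
  also have "u \<bullet> (ricci G x *v (I x *v v)) = - ((I x *v u) \<bullet> (ricci G x *v v))"
    using ricci_I[OF assms, of u "I x *v v"] by (simp add: I_I[OF assms] vec.neg)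
  finally show ?thesis using ricci_sym[OF assms, of v "I x *v u"] by simp
qed

end

section \<open>Hessians, the Laplacian and covariant derivatives of endomorphisms\<close>

definition hess :: "(real^'n \<Rightarrow> real^'n^'n) \<Rightarrow> (real^'n \<Rightarrow> real) \<Rightarrow> real^'n \<Rightarrow> real^'n \<Rightarrow> real^'n \<Rightarrow> real" where
  "hess G f x u v = fd (\<lambda>y. fd f y v) x u - fd f x (gam G x u *v v)"

text \<open>The Hessian with one index raised. Its trace is the Laplacian, which avoids orthonormal
  frames.\<close>

definition covgrad :: "(real^'n \<Rightarrow> real^'n^'n) \<Rightarrow> (real^'n \<Rightarrow> real) \<Rightarrow> real^'n \<Rightarrow> real^'n \<Rightarrow> real^'n" where
  "covgrad G f x u = fd (grad G f) x u + gam G x u *v grad G f x"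

lemma bounded_bilinear_mult_vector:
  "bounded_bilinear ((*v) :: real^'n^'m \<Rightarrow> real^'n \<Rightarrow> real^'m)"
  unfolding bilinear_conv_bounded_bilinear[symmetric] bilinear_def
  by (auto intro!: linearI simp: algebra_simps scaleR_matrix_vector_assoc[symmetric])

lemma fd_bilinear:
  assumes "bounded_bilinear p" "A differentiable (at x)" "B differentiable (at x)"
  shows "fd (\<lambda>y. p (A y) (B y)) x v = p (A x) (fd B x v) + p (fd A x v) (B x)"
    "(\<lambda>y. p (A y) (B y)) differentiable (at x)"
  using bounded_bilinear.FDERIV[OF assms(1) assms(2,3)[unfolded frechet_derivative_works]]
  by (auto simp: differentiable_def fd_unique)

lemma fd_partials:
  fixes f :: "real^'n \<Rightarrow> real"
  assumes "f differentiable (at x)"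
  shows "u \<bullet> (\<chi> j. pd j f x) = fd f x u"
  unfolding linear_axis_expansion[OF linear_frechet_derivative[OF assms], of u]
  by (simp add: inner_vec_def pd_def)

context metric_chart
begin

lemma grad_C1:
  assumes "Ck_on 2 U f" shows "Ck_on 1 U (grad G f)"
proof -
  have "Ck_on 1 U (\<lambda>x. \<chi> j. pd j f x)"
    by (rule Ck_on_vec[OF open_U]) (simp only: pd_def vec_lambda_beta Ck_on_2D(2)[OF assms])
  then have "Ck_on 1 U (\<lambda>x. matrix_inv (G x) *v (\<chi> j. pd j f x))"
    by (rule Ck_on_bilinear[OF open_U bounded_bilinear_mult_vector Ck_on_2D(3)[OF G_inv_C2]])
  then show ?thesis unfolding grad_def[abs_def] .
qed

lemma inner_grad:
  assumes "Ck_on 2 U f" "x \<in> U"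
  shows "u \<bullet> (G x *v grad G f x) = fd f x u"
  using fd_partials[OF Ck_on_2D(1)[OF assms]] G_inv(1)[OF assms(2)]
  by (simp add: grad_def matrix_vector_mul_assoc matrix_mul_assoc)

lemma hess_symmetric:
  assumes "Ck_on 2 U f" "x \<in> U" shows "hess G f x u v = hess G f x v u"
  unfolding hess_def gam_sym[OF assms(2), of u v] second_derivative_symmetric[OF open_U assms, of u v] ..

lemma linear_covgrad:
  assumes "Ck_on 2 U f" "x \<in> U" shows "linear (covgrad G f x)"
  using linear_frechet_derivative[OF Ck_on_1D[OF grad_C1[OF assms(1)] assms(2)]]
  by (auto intro!: linearI simp: covgrad_def linear_add linear_scale gam_add gam_scale algebra_simps
    scaleR_matrix_vector_assoc[symmetric])

lemma inner_covgrad: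
  assumes "Ck_on 2 U f" "x \<in> U"
  shows "v \<bullet> (G x *v covgrad G f x u) = hess G f x u v"
proof -
  have d: "G differentiable (at x)" "grad G f differentiable (at x)" "(\<lambda>y. fd f y v) differentiable (at x)"
    using Ck_on_2D(1)[OF G_C2] Ck_on_1D[OF grad_C1[OF assms(1)]] Ck_on_1D[OF Ck_on_2D(2)[OF assms(1)]] assms(2)
    by auto
  have "fd (\<lambda>y. fd f y v) x u = fd (\<lambda>y. v \<bullet> (G y *v grad G f y)) x u"
    by (rule fun_cong[OF fd_transfer[OF open_U assms(2) d(3)]]) (simp add: inner_grad[OF assms(1)])
  also have "\<dots> = v \<bullet> (G x *v fd (grad G f) x u + fd G x u *v grad G f x)"
    using fd_bounded_linear[OF bounded_linear_inner_right fd_bilinear(2)[OF bounded_bilinear_mult_vector d(1,2)]]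
      fd_bilinear(1)[OF bounded_bilinear_mult_vector d(1,2)] by metis
  finally show ?thesis
    unfolding hess_def covgrad_def metric_compatible[OF assms(2)] inner_grad[OF assms, symmetric]
    by (simp add: matrix_vector_mult_add_rdistrib matrix_vector_right_distrib matrix_vector_mul_assoc[symmetric]
      inner_add_right inner_transpose del: transpose_matrix_vector)
qed

lemma laplacian_tr:
  assumes "Ck_on 2 U f" "x \<in> U"
  shows "laplacian G f x = tr (covgrad G f x)"
proof -
  have "pd i (\<lambda>y. grad G f y $ i) x = fd (grad G f) x (axis i 1) $ i" for i
    unfolding pd_def by (rule fd_bounded_linear[OF bounded_linear_vec_nth Ck_on_1D[OF grad_C1]]) (use assms in auto)
  then show ?thesis
    by (simp add: laplacian_def divergence_def tr_def covgrad_def gam_axis matrix_vector_mult_def)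
qed

lemma cov_cong:
  assumes "x \<in> U" "S differentiable (at x)" "\<And>y. y \<in> U \<Longrightarrow> S y = T y"
  shows "cov G S x u = cov G T x u"
proof -
  have "fd S x = fd T x" by (rule fd_transfer[OF open_U assms])
  then show ?thesis by (simp add: cov_def assms(3)[OF assms(1)])
qed

lemma cov_mult:
  assumes "S differentiable (at x)" "T differentiable (at x)"
  shows "cov G (\<lambda>y. S y ** T y) x u = cov G S x u ** T x + S x ** cov G T x u"
  unfolding cov_def fd_matrix_mult[OF assms]
  by (simp add: matrix_ring_simps matrix_mul_assoc algebra_simps)

lemma cov_scaleR:
  fixes a :: "real^'n \<Rightarrow> real"
  assumes "a differentiable (at x)" "T differentiable (at x)"
  shows "cov G (\<lambda>y. a y *\<^sub>R T y) x u = fd a x u *\<^sub>R T x + a x *\<^sub>R cov G T x u"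
  unfolding cov_def fd_bilinear(1)[OF bounded_bilinear_scaleR assms]
  by (simp add: matrix_ring_simps algebra_simps)

lemma cov_add:
  assumes "S differentiable (at x)" "T differentiable (at x)"
  shows "cov G (\<lambda>y. S y + T y) x u = cov G S x u + cov G T x u"
  unfolding cov_def fd_add[OF assms]
  by (simp add: matrix_ring_simps algebra_simps)

lemma linear_cov: 
  assumes "T differentiable (at x)" shows "linear (cov G T x)"
  using linear_frechet_derivative[OF assms]
  by (auto intro!: linearI simp: cov_def linear_add linear_scale gam_add gam_scale matrix_ring_simps algebra_simps)

text \<open>Lowering an index commutes with covariant differentiation because the metric is
  parallel; the first two summands are the connection acting on the bilinear form.\<close>

lemma fd_lower:
  assumes x: "x \<in> U" and T: "T differentiable (at x)"
    and W: "\<And>y. y \<in> U \<Longrightarrow> W y = transpose (T y) ** G y" "W differentiable (at x)"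
  shows "fd W x u = transpose (gam G x u) ** W x + W x ** gam G x u + transpose (cov G T x u) ** G x"
proof -
  have t: "(\<lambda>y. transpose (T y)) differentiable (at x)"
    using bounded_linear.has_derivative[OF bounded_linear_transpose T[unfolded frechet_derivative_works]]
    by (auto simp: differentiable_def)
  have "fd W x = fd (\<lambda>y. transpose (T y) ** G y) x"
    by (rule fd_transfer[OF open_U x W(2)]) (rule W(1))
  then have "fd W x u = transpose (T x) ** fd G x u + transpose (fd T x u) ** G x"
    using fd_matrix_mult[OF t Ck_on_2D(1)[OF G_C2 x]] fd_bounded_linear[OF bounded_linear_transpose T] by simp
  then show ?thesis
    unfolding metric_compatible[OF x] W(1)[OF x] cov_def
    by (simp add: transpose_add transpose_diff matrix_transpose_mul matrix_ring_simps matrix_mul_assoc algebra_simps)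
qed

text \<open>The exterior derivative of a two-form, computed with the Levi-Civita connection:
  torsion-freeness and skewness cancel the connection terms in pairs. It is used in both directions,
  from parallel to closed in the ambient manifold and from closed to a condition on the covariant
  derivative of \<open>S\<close>.\<close>

lemma cyclic_fd_lower:
  assumes x: "x \<in> U" and T: "T differentiable (at x)"
    and W: "\<And>y. y \<in> U \<Longrightarrow> W y = transpose (T y) ** G y" "W differentiable (at x)"
    and skew: "\<And>u v. u \<bullet> (W x *v v) = - (v \<bullet> (W x *v u))"
  shows "v \<bullet> (fd W x u *v w) + w \<bullet> (fd W x v *v u) + u \<bullet> (fd W x w *v v) =
    (cov G T x u *v v) \<bullet> (G x *v w) + (cov G T x v *v w) \<bullet> (G x *v u) + (cov G T x w *v u) \<bullet> (G x *v v)"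
proof -
  have "v \<bullet> (fd W x u *v w) = (gam G x u *v v) \<bullet> (W x *v w) + v \<bullet> (W x *v (gam G x u *v w))
      + (cov G T x u *v v) \<bullet> (G x *v w)" for u v w
  proof -
    have "fd W x u = transpose (gam G x u) ** W x + W x ** gam G x u + transpose (cov G T x u) ** G x"
      by (rule fd_lower[OF x T W])
    then show ?thesis
      by (simp add: matrix_vector_mult_add_rdistrib matrix_vector_mul_assoc[symmetric]
        inner_add_right inner_transpose del: transpose_matrix_vector)
  qed
  then show ?thesis
    using skew[of w "gam G x u *v v"] skew[of v "gam G x u *v w"] skew[of u "gam G x v *v w"]
    by (simp add: gam_sym[OF x, of v u] gam_sym[OF x, of w u] gam_sym[OF x, of w v])
qed

end

context kaehler_chart
begin

text \<open>Since \<open>I\<close> is parallel, the derivative of \<open>df(I v)\<close> along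
  \<open>u\<close> is the Hessian at \<open>u\<close> and \<open>I v\<close> plus \<open>df\<close>
  of \<open>I\<close> applied to the Christoffel term of \<open>u\<close> and \<open>v\<close>. The
  latter is symmetric and drops out.\<close>

lemma ext_d1_I:
  assumes "Ck_on 2 U f" "x \<in> U"
  shows "ext_d1 (\<lambda>y Z. fd f y (I y *v Z)) x u v = hess G f x u (I x *v v) - hess G f x v (I x *v u)"
proof -
  \<comment> \<open>The direction \<open>I y *v v\<close> moves with \<open>y\<close>; writing
    \<open>df\<close> as an inner product with the vector of partials makes the product rule
    applicable.\<close>
  define p where "p y = (\<chi> j. pd j f y)" for y
  have p1: "Ck_on 1 U p" unfolding p_def
    by (rule Ck_on_vec[OF open_U]) (simp only: pd_def vec_lambda_beta Ck_on_2D(2)[OF assms(1)])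
  have p: "fd f y w = w \<bullet> p y" if "y \<in> U" for y w
    unfolding p_def using fd_partials[OF Ck_on_2D(1)[OF assms(1) that]] by simp
  have dp: "p differentiable (at x)" using Ck_on_1D[OF p1 assms(2)] .
  have dI: "I differentiable (at x)" using Ck_on_2D(1)[OF I_C2 assms(2)] .
  have dIv: "(\<lambda>y. I y *v v) differentiable (at x)" "fd (\<lambda>y. I y *v v) x u = fd I x u *v v" for u v
    using bounded_linear.has_derivative[OF bounded_linear_mult_vector dI[unfolded frechet_derivative_works]]
      fd_bounded_linear[OF bounded_linear_mult_vector dI] by (auto simp: differentiable_def)
  have "fd (\<lambda>y. fd f y w) x u = w \<bullet> fd p x u" for u w
  proof -
    have "fd (\<lambda>y. w \<bullet> p y) x = fd (\<lambda>y. fd f y w) x"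
      by (rule fd_transfer[OF open_U assms(2)])
        (use fd_bilinear(2)[OF bounded_bilinear_inner _ dp] in \<open>auto simp: p\<close>)
    then show ?thesis using fd_bounded_linear[OF bounded_linear_inner_right dp] by metis
  qed
  moreover have "fd (\<lambda>y. fd f y (I y *v v)) x u = (I x *v v) \<bullet> fd p x u + (fd I x u *v v) \<bullet> p x" for u v
  proof -
    have "fd (\<lambda>y. (I y *v v) \<bullet> p y) x = fd (\<lambda>y. fd f y (I y *v v)) x"
      by (rule fd_transfer[OF open_U assms(2)])
        (use fd_bilinear(2)[OF bounded_bilinear_inner dIv(1) dp] in \<open>auto simp: p\<close>)
    then show ?thesis using fd_bilinear(1)[OF bounded_bilinear_inner dIv(1) dp] dIv(2) by metis
  qed
  moreover have "fd I x u *v v = I x *v (gam G x u *v v) - gam G x u *v (I x *v v)" for u v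
  proof -
    have "fd I x u = I x ** gam G x u - gam G x u ** I x"
      using I_parallel[OF assms(2), of u] unfolding cov_def by (simp add: algebra_simps)
    then show ?thesis
      by (simp add: matrix_vector_mult_diff_rdistrib matrix_vector_mul_assoc[symmetric])
  qed
  ultimately show ?thesis
    unfolding ext_d1_def hess_def p[OF assms(2)]
    by (simp add: inner_diff_left gam_sym[OF assms(2), of v u])
qed

text \<open>The assumption at \<open>- I u\<close> gives \<open>Ricci(u, v) = (Hess f(I u, I v) + Hess f(u, v)) / 2\<close>.\<close>

lemma scalar_curvature_laplacian:
  assumes f: "Ck_on 2 U f" and x: "x \<in> U"
    and ric: "\<And>u v. (I x *v u) \<bullet> (ricci G x *v v) =
      - 1 / 2 * ext_d1 (\<lambda>y Z. fd f y (I y *v Z)) x u v"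
  shows "scalar_curvature G x = laplacian G f x"
proof -
  let ?N = "covgrad G f x"
  note lin = linear_covgrad[OF f x]
  have "v \<bullet> (ricci G x *v u) = v \<bullet> (G x *v ((1/2) *\<^sub>R (?N u - I x *v ?N (I x *v u))))" for u v
  proof -
    have "v \<bullet> (ricci G x *v u) = 1 / 2 * (hess G f x (I x *v v) (I x *v u) + hess G f x u v)"
      using ric[of "I x *v v" "- u"] unfolding ext_d1_I[OF f x] I_I[OF x]
      by (simp add: inner_covgrad[OF f x, symmetric] linear_neg[OF lin] vec.neg) (simp add: field_simps)
    also have "\<dots> = 1 / 2 * ((I x *v v) \<bullet> (G x *v ?N (I x *v u)) + v \<bullet> (G x *v ?N u))"
      unfolding hess_symmetric[OF f x, of "I x *v v"] inner_covgrad[OF f x] ..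
    finally show ?thesis
      by (simp add: I_skew[OF x] matrix_vector_mult_scaleR matrix_vector_mult_diff_distrib inner_diff_right)
  qed
  then have "ricci G x *v u = G x *v ((1/2) *\<^sub>R (?N u - I x *v ?N (I x *v u)))" for u
    by (metis vector_eq_ldot)
  then have "matrix_inv (G x) *v (ricci G x *v u) = (1/2) *\<^sub>R (?N u - I x *v ?N (I x *v u))" for u
    by (simp only: matrix_vector_mul_assoc G_inv[OF x] matrix_vector_mul_lid)
  then have "scalar_curvature G x = tr (\<lambda>u. (1/2) *\<^sub>R (?N u - I x *v ?N (I x *v u)))"
    using tr_matrix[of "matrix_inv (G x) ** ricci G x"]
    by (simp add: scalar_curvature_def matrix_vector_mul_assoc[symmetric] tr_def)
  also have "\<dots> = 1 / 2 * (tr ?N - tr (\<lambda>u. I x *v ?N (I x *v u)))"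
    by (simp add: tr_def sum_subtractf[symmetric] sum_distrib_left)
  \<comment> \<open>Cyclicity and \<open>I^2 = - 1\<close> give the second part the same trace as
    the first, which absorbs the factor 1/2.\<close>
  also have "tr (\<lambda>u. I x *v ?N (I x *v u)) = tr (\<lambda>u. ?N (I x *v (I x *v u)))"
    by (rule tr_comm[symmetric, OF linear_compose[OF matrix_vector_mul_linear lin, unfolded o_def]])
  also have "\<dots> = - tr ?N"
    unfolding I_I[OF x] linear_neg[OF lin] by (rule tr_minus)
  finally show ?thesis by (simp add: laplacian_tr[OF f x])
qed

end

section \<open>Quaternionic structures on a four-dimensional space\<close>

text \<open>\<open>I\<close>, \<open>S / sqrt \<phi>\<close> and their product satisfy the
  quaternion relations. \<open>S\<close> stays unnormalised because it is the field with the closed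
  form, and the one that is differentiated later.\<close>

locale quaternionic_space =
  fixes G I S :: "real^4^4" and \<phi> :: real
  assumes G_sym: "\<And>u v. u \<bullet> (G *v v) = v \<bullet> (G *v u)"
    and G_pos: "\<And>u. u \<noteq> 0 \<Longrightarrow> u \<bullet> (G *v u) > 0"
    and I_I: "\<And>v. I *v (I *v v) = - v"
    and S_S: "\<And>v. S *v (S *v v) = - \<phi> *\<^sub>R v"
    and S_I: "\<And>v. S *v (I *v v) = - (I *v (S *v v))"
    and I_skew: "\<And>u v. (I *v u) \<bullet> (G *v v) = - (u \<bullet> (G *v (I *v v)))"
    and S_skew: "\<And>u v. (S *v u) \<bullet> (G *v v) = - (u \<bullet> (G *v (S *v v)))"
    and \<phi>_pos: "\<phi> > 0"
begin

lemma skew_zero: "(\<And>u v. (A *v u) \<bullet> (G *v v) = - (u \<bullet> (G *v (A *v v)))) \<Longrightarrow> u \<bullet> (G *v (A *v u)) = 0"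
  using G_sym[of u "A *v u"] by (metis add.inverse_neutral eq_neg_iff_add_eq_0 mult_2 mult_eq_0_iff zero_neq_numeral)

lemma I_zero: "u \<bullet> (G *v (I *v u)) = 0"
  by (rule skew_zero[OF I_skew])

lemma S_zero: "u \<bullet> (G *v (S *v u)) = 0"
  by (rule skew_zero[OF S_skew])

lemma IS_skew: "(I *v (S *v u)) \<bullet> (G *v v) = - (u \<bullet> (G *v (I *v (S *v v))))"
  by (simp add: I_skew S_skew S_I vec.neg)

lemma IS_zero: "u \<bullet> (G *v (I *v (S *v u))) = 0"
  using G_sym[of u "I *v (S *v u)"] IS_skew[of u u] by simp

text \<open>The four vectors are pairwise orthogonal and nonzero, so the coefficient map is
  injective; dimension four makes it surjective.\<close>

lemma frame:
  assumes "e \<noteq> 0"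
  obtains a b c d where "z = a *\<^sub>R e + b *\<^sub>R (I *v e) + c *\<^sub>R (S *v e) + d *\<^sub>R (I *v (S *v e))"
proof -
  define f where "f t = t $ 1 *\<^sub>R e + t $ 2 *\<^sub>R (I *v e) + t $ 3 *\<^sub>R (S *v e) + t $ 4 *\<^sub>R (I *v (S *v e))" for t :: "real^4"
  have lin: "linear f"
    by (auto intro!: linearI simp: f_def algebra_simps)
  have n: "e \<bullet> (G *v e) > 0" using G_pos[OF assms] .
  have "t = 0" if "f t = 0" for t
  proof -
    note zeros = I_zero S_zero IS_zero I_skew S_skew S_I I_I S_S vec.neg matrix_vector_mult_scaleR
    have "e \<bullet> (G *v f t) = t $ 1 * (e \<bullet> (G *v e))"
      by (simp add: f_def matrix_vector_right_distrib inner_add_right zeros)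
    moreover have "(I *v e) \<bullet> (G *v f t) = t $ 2 * (e \<bullet> (G *v e))"
      by (simp add: f_def matrix_vector_right_distrib inner_add_right zeros)
    moreover have "(S *v e) \<bullet> (G *v f t) = t $ 3 * \<phi> * (e \<bullet> (G *v e))"
      by (simp add: f_def matrix_vector_right_distrib inner_add_right zeros)
    moreover have "(I *v (S *v e)) \<bullet> (G *v f t) = t $ 4 * \<phi> * (e \<bullet> (G *v e))"
      by (simp add: f_def matrix_vector_right_distrib inner_add_right zeros)
    ultimately show "t = 0" using that n \<phi>_pos by (simp add: vec_eq_iff forall_4)
  qed
  then have "inj f" using linear_injective_0[OF lin] by blast
  then have "surj f" using linear_injective_imp_surjective[OF lin] by simp
  then obtain t where "z = f t" by (metis surjD)
  then show thesis using that unfolding f_def by blast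
qed

text \<open>For skew \<open>A\<close> among \<open>I\<close>, \<open>S\<close>, \<open>I S\<close> the product \<open>A Q\<close> is skew, so \<open>Q e\<close> is orthogonal to \<open>A e\<close>;
  hence every vector is an eigenvector of \<open>Q\<close>.\<close>

lemma commutant_scalar:
  assumes QI: "\<And>v. Q *v (I *v v) = I *v (Q *v v)" and QS: "\<And>v. Q *v (S *v v) = S *v (Q *v v)"
    and Q_sym: "\<And>u v. (Q *v u) \<bullet> (G *v v) = u \<bullet> (G *v (Q *v v))"
  obtains q where "\<And>z. Q *v z = q *\<^sub>R z"
proof -
  define e :: "real^4" where "e = axis 1 1"
  have e: "e \<noteq> 0" by (simp add: e_def axis_eq_0_iff)
  then have n: "e \<bullet> (G *v e) > 0" using G_pos by blast
  have z: "(A *v e) \<bullet> (G *v (Q *v e)) = 0"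
    if "\<And>v. Q *v (A *v v) = A *v (Q *v v)" "\<And>u v. (A *v u) \<bullet> (G *v v) = - (u \<bullet> (G *v (A *v v)))" for A
    using that Q_sym G_sym by (metis add.inverse_neutral add.inverse_inverse eq_neg_iff_add_eq_0 mult_2 mult_eq_0_iff zero_neq_numeral)
  obtain a b c d where Q: "Q *v e = a *\<^sub>R e + b *\<^sub>R (I *v e) + c *\<^sub>R (S *v e) + d *\<^sub>R (I *v (S *v e))"
    using frame[OF e] .
  note zeros = I_zero S_zero IS_zero I_skew S_skew S_I I_I S_S vec.neg matrix_vector_mult_scaleR
  have "(I *v e) \<bullet> (G *v (Q *v e)) = b * (e \<bullet> (G *v e))"
    by (simp add: Q matrix_vector_right_distrib inner_add_right zeros)
  then have "b = 0" using z[OF QI I_skew] n by simp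
  have "(S *v e) \<bullet> (G *v (Q *v e)) = c * \<phi> * (e \<bullet> (G *v e))"
    by (simp add: Q matrix_vector_right_distrib inner_add_right zeros)
  then have "c = 0" using z[OF QS S_skew] n \<phi>_pos by simp
  have "(I *v (S *v e)) \<bullet> (G *v (Q *v e)) = d * \<phi> * (e \<bullet> (G *v e))"
    by (simp add: Q matrix_vector_right_distrib inner_add_right zeros)
  moreover have "((I ** S) *v e) \<bullet> (G *v (Q *v e)) = 0"
    by (rule z) (simp_all add: matrix_vector_mul_assoc[symmetric] QI QS IS_skew)
  ultimately have "d = 0" using n \<phi>_pos by (simp add: matrix_vector_mul_assoc)
  have Qe: "Q *v e = a *\<^sub>R e" using Q \<open>b = 0\<close> \<open>c = 0\<close> \<open>d = 0\<close> by simp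
  have "Q *v z = a *\<^sub>R z" for z
  proof -
    obtain a' b' c' d' where z: "z = a' *\<^sub>R e + b' *\<^sub>R (I *v e) + c' *\<^sub>R (S *v e) + d' *\<^sub>R (I *v (S *v e))"
      using frame[OF e] .
    show ?thesis unfolding z by (simp add: matrix_vector_right_distrib matrix_vector_mult_scaleR QI QS Qe algebra_simps)
  qed
  then show thesis using that by blast
qed

text \<open>Apply the preceding lemma to \<open>(P - m S) I S\<close>.\<close>

lemma anticommuting_skew:
  assumes P_skew: "\<And>u v. (P *v u) \<bullet> (G *v v) = - (u \<bullet> (G *v (P *v v)))"
    and PI: "\<And>v. P *v (I *v v) = - (I *v (P *v v))"
    and PS: "\<And>v. P *v (S *v v) + S *v (P *v v) = - (2 * \<phi> * m) *\<^sub>R v"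
  obtains n where "\<And>v. P *v v = m *\<^sub>R (S *v v) + n *\<^sub>R (I *v (S *v v))"
proof -
  define P' where "P' = P - m *\<^sub>R S"
  have P': "P' *v v = P *v v - m *\<^sub>R (S *v v)" for v
    by (simp add: P'_def matrix_vector_mult_diff_rdistrib scaleR_matrix_vector_assoc)
  have P'_skew: "(P' *v u) \<bullet> (G *v v) = - (u \<bullet> (G *v (P' *v v)))" for u v
    by (simp add: P' inner_diff_left inner_diff_right matrix_vector_mult_diff_distrib matrix_vector_mult_scaleR P_skew S_skew)
  have P'I: "P' *v (I *v v) = - (I *v (P' *v v))" for v
    by (simp add: P' PI S_I matrix_vector_mult_diff_distrib matrix_vector_mult_scaleR)
  have P'S: "P' *v (S *v v) = - (S *v (P' *v v))" for v
    using PS[of v] by (simp add: P' S_S matrix_vector_mult_diff_distrib matrix_vector_mult_scaleR eq_neg_iff_add_eq_0 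
      scaleR_add_left[symmetric] algebra_simps)
  have "(P' ** I ** S) *v (I *v v) = I *v ((P' ** I ** S) *v v)"
    and "(P' ** I ** S) *v (S *v v) = S *v ((P' ** I ** S) *v v)"
    and "((P' ** I ** S) *v u) \<bullet> (G *v v) = u \<bullet> (G *v ((P' ** I ** S) *v v))" for u v
    by (simp_all add: matrix_vector_mul_assoc[symmetric] P'I P'S S_I P'_skew I_skew S_skew vec.neg)
  then obtain q where q: "\<And>z. (P' ** I ** S) *v z = q *\<^sub>R z"
    using commutant_scalar[of "P' ** I ** S"] by metis
  have "P' *v z = (- q / \<phi>) *\<^sub>R (I *v (S *v z))" for z
  proof -
    have "- \<phi> *\<^sub>R (P' *v z) = q *\<^sub>R (I *v (S *v z))"
      using q[of "I *v (S *v z)"]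
      by (simp add: matrix_vector_mul_assoc[symmetric] S_I I_I S_S vec.neg matrix_vector_mult_scaleR)
    then have "(- 1 / \<phi>) *\<^sub>R (- \<phi> *\<^sub>R (P' *v z)) = (- 1 / \<phi>) *\<^sub>R (q *\<^sub>R (I *v (S *v z)))" by simp
    then show ?thesis using \<phi>_pos by simp
  qed
  then have "P *v z = m *\<^sub>R (S *v z) + (- q / \<phi>) *\<^sub>R (I *v (S *v z))" for z
    using P'[of z] by (simp add: algebra_simps)
  then show thesis by (rule that)
qed

text \<open>On \<open>X\<close>, \<open>I X\<close>, \<open>S X\<close> the three terms are
  \<open>\<phi> n(X) |X|^2\<close>, \<open>- \<phi> m(I X) |X|^2\<close> and zero. The third
  vanishes by orthogonality, whatever the coefficients at \<open>S X\<close> are.\<close>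

lemma closed_coefficients:
  assumes P: "\<And>X v. P X *v v = m X *\<^sub>R (S *v v) + n X *\<^sub>R (I *v (S *v v))"
    and closed: "\<And>u v w. (P u *v v) \<bullet> (G *v w) + (P v *v w) \<bullet> (G *v u) + (P w *v u) \<bullet> (G *v v) = 0"
    and "X \<noteq> 0"
  shows "n X = m (I *v X)"
proof -
  have "\<phi> * (n X - m (I *v X)) * (X \<bullet> (G *v X)) = 0"
    using closed[of X "I *v X" "S *v X"]
    by (simp add: P inner_add_left S_I I_I S_S vec.neg I_zero S_zero IS_zero I_skew S_skew matrix_vector_mult_scaleR algebra_simps)
  then show ?thesis using G_pos[OF \<open>X \<noteq> 0\<close>] \<phi>_pos by simp
qed

end

section \<open>Kaehler surfaces with a closed form of anti-invariant type\<close>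

text \<open>The last assumption is closedness of the two-form \<open>g(S u, v)\<close>: on constant
  fields its exterior derivative is this cyclic sum of partial derivatives.\<close>

locale kaehler_surface = kaehler_chart U G I for U and G I :: "real^4 \<Rightarrow> real^4^4" +
  fixes S :: "real^4 \<Rightarrow> real^4^4" and \<phi> :: "real^4 \<Rightarrow> real"
  assumes S_C2: "Ck_on 2 U S"
    and S_skew: "x \<in> U \<Longrightarrow> (S x *v u) \<bullet> (G x *v v) = - (u \<bullet> (G x *v (S x *v v)))"
    and I_S: "x \<in> U \<Longrightarrow> I x ** S x = - (S x ** I x)"
    and S_square: "x \<in> U \<Longrightarrow> S x ** S x = - \<phi> x *\<^sub>R mat 1"
    and \<phi>_pos: "x \<in> U \<Longrightarrow> \<phi> x > 0"
    and closed: "x \<in> U \<Longrightarrow> v \<bullet> (fd (\<lambda>y. transpose (S y) ** G y) x u *v w)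
      + w \<bullet> (fd (\<lambda>y. transpose (S y) ** G y) x v *v u)
      + u \<bullet> (fd (\<lambda>y. transpose (S y) ** G y) x w *v v) = 0"
begin

definition L :: "real^4 \<Rightarrow> real" where "L x = ln (\<phi> x)"

text \<open>No regularity of \<open>\<phi>\<close> is assumed; it is inherited from
  \<open>S\<close>, as \<open>\<phi>\<close> is minus a diagonal entry of
  \<open>S^2\<close>.\<close>

lemma \<phi>_C2: "Ck_on 2 U \<phi>"
proof -
  have "Ck_on 2 U (\<lambda>x. - ((S x ** S x) $ 1 $ 1))"
    by (intro Ck_on_uminus Ck_on_nth open_U Ck_on_bilinear[OF _ bounded_bilinear_matrix_mult] S_C2)
  then show ?thesis
    by (rule Ck_on_cong[OF open_U, rotated]) (simp add: S_square mat_def)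
qed

lemma L_C2: "Ck_on 2 U L"
  unfolding L_def[abs_def] by (rule Ck_on_ln[OF open_U \<phi>_C2 \<phi>_pos])

lemmas L_diff = Ck_on_2D(1)[OF L_C2]
lemmas S_diff = Ck_on_2D(1)[OF S_C2]
lemmas I_diff = Ck_on_2D(1)[OF I_C2]
lemmas \<phi>_diff = Ck_on_2D(1)[OF \<phi>_C2]

lemma d\<phi>: 
  assumes "x \<in> U" shows "fd \<phi> x u = \<phi> x * fd L x u"
proof -
  have "(L has_derivative (\<lambda>u. fd \<phi> x u * inverse (\<phi> x))) (at x)"
    unfolding L_def[abs_def]
    using has_derivative_ln[OF \<phi>_pos[OF assms] \<phi>_diff[OF assms, unfolded frechet_derivative_works]]
    by simp
  from fd_unique[OF this] show ?thesis using \<phi>_pos[OF assms] by (simp add: field_simps)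
qed

lemma quaternionic:
  assumes "x \<in> U" shows "quaternionic_space (G x) (I x) (S x) (\<phi> x)"
proof
  show "S x *v (S x *v v) = - \<phi> x *\<^sub>R v" for v
    by (simp add: matrix_vector_mul_assoc S_square[OF assms] scaleR_matrix_vector_assoc[symmetric] matrix_vector_minus)
  show "S x *v (I x *v v) = - (I x *v (S x *v v))" for v
    by (simp add: matrix_vector_mul_assoc I_S[OF assms] matrix_vector_minus)
qed (use assms in \<open>auto intro: G_sym G_pos simp: I_I I_skew S_skew \<phi>_pos\<close>)

lemma S_transpose: 
  assumes "x \<in> U" shows "transpose (S x) ** G x = - (G x ** S x)"
proof -
  have "u \<bullet> ((transpose (S x) ** G x) *v v) = u \<bullet> (- (G x ** S x) *v v)" for u v
    using S_skew[OF assms, of u v]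
    by (simp add: matrix_vector_mul_assoc[symmetric] matrix_vector_minus inner_transpose del: transpose_matrix_vector)
  then show ?thesis unfolding matrix_eq by (metis vector_eq_ldot)
qed

text \<open>In \<open>fd_lower\<close> the derivative of the skew matrix \<open>W\<close> is skew,
  and so are the two connection terms together; hence the remaining summand is skew as well.\<close>

lemma cov_S_skew:
  assumes "x \<in> U"
  shows "(cov G S x w *v u) \<bullet> (G x *v v) = - (u \<bullet> (G x *v (cov G S x w *v v)))"
proof -
  define W where "W y = transpose (S y) ** G y" for y
  have "(\<lambda>y. transpose (S y)) differentiable (at x)"
    using bounded_linear.has_derivative[OF bounded_linear_transpose S_diff[OF assms, unfolded frechet_derivative_works]]
    by (auto simp: differentiable_def)
  then have W: "W differentiable (at x)"
    unfolding W_def by (rule differentiable_matrix_mult[OF _ Ck_on_2D(1)[OF G_C2 assms]])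
  have tW: "transpose (W y) = - W y" if "y \<in> U" for y
  proof -
    have "transpose (W y) = G y ** S y" by (simp add: W_def matrix_transpose_mul G_transpose[OF that])
    then show ?thesis by (simp add: W_def S_transpose[OF that])
  qed
  have "fd (\<lambda>y. - W y) x = fd (\<lambda>y. transpose (W y)) x"
    by (rule fd_transfer[OF open_U assms]) (use W tW in auto)
  then have "transpose (fd W x w) = - fd W x w"
    using fd_bounded_linear[OF bounded_linear_transpose W, of w] 
      fd_bounded_linear[OF bounded_linear_minus[OF bounded_linear_ident] W, of w] by simp
  then have "transpose (transpose (cov G S x w) ** G x) = - (transpose (cov G S x w) ** G x)"
    using fd_lower[OF assms S_diff[OF assms] W_def W, of w]
    by (simp add: tW[OF assms] transpose_add matrix_transpose_mul matrix_ring_simps)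
  then have "G x ** cov G S x w = - (transpose (cov G S x w) ** G x)"
    by (simp add: matrix_transpose_mul G_transpose[OF assms])
  then have "u \<bullet> ((G x ** cov G S x w) *v v) = - (u \<bullet> ((transpose (cov G S x w) ** G x) *v v))"
    by (simp add: matrix_vector_minus)
  then show ?thesis
    by (simp add: matrix_vector_mul_assoc[symmetric] inner_transpose del: transpose_matrix_vector)
qed

lemma cov_S_I:
  assumes "x \<in> U"
  shows "cov G S x w ** I x = - (I x ** cov G S x w)"
proof -
  have neg: "(\<lambda>y. - (S y ** I y)) = (\<lambda>y. (- 1) *\<^sub>R (S y ** I y))" by simp
  have SI: "(\<lambda>y. S y ** I y) differentiable (at x)" "(\<lambda>y. I y ** S y) differentiable (at x)"
    by (auto intro!: differentiable_matrix_mult S_diff I_diff assms)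
  have "cov G (\<lambda>y. I y ** S y) x w = cov G (\<lambda>y. - (S y ** I y)) x w"
    by (rule cov_cong[OF assms SI(2) I_S])
  also have "\<dots> = - cov G (\<lambda>y. S y ** I y) x w"
    unfolding neg by (subst cov_scaleR[OF _ SI(1)]) auto
  finally show ?thesis
    by (simp add: cov_mult[OF I_diff[OF assms] S_diff[OF assms]] cov_mult[OF S_diff[OF assms] I_diff[OF assms]]
      I_parallel[OF assms] matrix_ring_simps)
qed

lemma cov_S_S:
  assumes "x \<in> U"
  shows "cov G S x w ** S x + S x ** cov G S x w = - fd \<phi> x w *\<^sub>R mat 1"
proof -
  have "cov G (\<lambda>y. S y ** S y) x w = cov G (\<lambda>y. (- \<phi> y) *\<^sub>R mat 1) x w"
    by (rule cov_cong[OF assms _ S_square]) (use differentiable_matrix_mult S_diff assms in auto)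
  also have "\<dots> = fd (\<lambda>y. - \<phi> y) x w *\<^sub>R mat 1 + (- \<phi> x) *\<^sub>R cov G (\<lambda>y. mat 1) x w"
    by (rule cov_scaleR) (use \<phi>_diff[OF assms] in auto)
  also have "cov G (\<lambda>y. mat 1) x w = 0" by (simp add: cov_def)
  also have "fd (\<lambda>y. - \<phi> y) x w = - fd \<phi> x w"
    by (rule fd_bounded_linear[OF bounded_linear_minus[OF bounded_linear_ident] \<phi>_diff[OF assms]])
  finally show ?thesis by (simp add: cov_mult[OF S_diff[OF assms] S_diff[OF assms]])
qed

text \<open>The vector comes first so that \<open>mu v\<close> and \<open>nu v\<close> are functions
  of the base point, ready to be differentiated. The half reflects that differentiating
  \<open>S^2 = - \<phi>\<close> produces the covariant derivative of \<open>S\<close> twice.\<close>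

definition mu where "mu v y = fd L y v / 2"
definition nu where "nu v y = fd L y (I y *v v) / 2"

lemma cov_S:
  assumes "x \<in> U"
  shows "cov G S x w = mu w x *\<^sub>R S x + nu w x *\<^sub>R (I x ** S x)"
proof -
  interpret q: quaternionic_space "G x" "I x" "S x" "\<phi> x" by (rule quaternionic[OF assms])
  have "\<exists>k. \<forall>v. cov G S x w *v v = mu w x *\<^sub>R (S x *v v) + k *\<^sub>R (I x *v (S x *v v))" for w
  proof -
    have "cov G S x w *v (I x *v v) = - (I x *v (cov G S x w *v v))" for v
      using cov_S_I[OF assms, of w] by (simp add: matrix_vector_mul_assoc matrix_vector_minus)
    moreover have "cov G S x w *v (S x *v v) + S x *v (cov G S x w *v v) = - (2 * \<phi> x * mu w x) *\<^sub>R v" for v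
    proof -
      have "(cov G S x w ** S x + S x ** cov G S x w) *v v = (- fd \<phi> x w *\<^sub>R mat 1) *v v"
        unfolding cov_S_S[OF assms] ..
      then show ?thesis
        by (simp add: matrix_vector_mul_assoc[symmetric] matrix_vector_mult_add_rdistrib d\<phi>[OF assms] mu_def
          scaleR_matrix_vector_assoc[symmetric] matrix_vector_minus)
    qed
    ultimately show ?thesis
      using q.anticommuting_skew[OF cov_S_skew[OF assms, of w]] by metis
  qed
  then obtain k where k: "\<And>w v. cov G S x w *v v = mu w x *\<^sub>R (S x *v v) + k w *\<^sub>R (I x *v (S x *v v))"
    by metis
  have W: "(\<lambda>y. transpose (S y) ** G y) differentiable (at x)"
    using bounded_linear.has_derivative[OF bounded_linear_transpose S_diff[OF assms, unfolded frechet_derivative_works]]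
    by (intro differentiable_matrix_mult[OF _ Ck_on_2D(1)[OF G_C2 assms]]) (auto simp: differentiable_def)
  have "u \<bullet> ((transpose (S x) ** G x) *v v) = - (v \<bullet> ((transpose (S x) ** G x) *v u))" for u v
    using S_skew[OF assms, of u v] G_sym[OF assms, of u "S x *v v"]
    by (simp add: matrix_vector_mul_assoc[symmetric] inner_transpose del: transpose_matrix_vector)
  from cyclic_fd_lower[OF assms S_diff[OF assms] refl W this]
  have cyc: "(cov G S x u *v v) \<bullet> (G x *v w) + (cov G S x v *v w) \<bullet> (G x *v u) + (cov G S x w *v u) \<bullet> (G x *v v) = 0"
    for u v w
    using closed[OF assms, of v u w] by simp
  have "k w = nu w x" if "w \<noteq> 0" for w
    using q.closed_coefficients[where m = "\<lambda>w. mu w x", OF k cyc that] by (simp add: nu_def mu_def)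
  \<comment> \<open>The zero vector is separate because \<open>closed_coefficients\<close> divides
    by the squared length.\<close>
  moreover have "cov G S x 0 = 0" "nu 0 x = 0" "mu 0 x = 0"
    using linear_0[OF linear_cov[OF S_diff[OF assms]]] linear_0[OF linear_frechet_derivative[OF L_diff[OF assms]]]
    by (auto simp: nu_def mu_def)
  ultimately show ?thesis
    by (cases "w = 0") (simp_all add: matrix_eq k matrix_vector_mult_add_rdistrib matrix_vector_mul_assoc[symmetric]
      scaleR_matrix_vector_assoc[symmetric])
qed

lemma cov_IS:
  assumes "x \<in> U"
  shows "cov G (\<lambda>y. I y ** S y) x w = mu w x *\<^sub>R (I x ** S x) - nu w x *\<^sub>R S x"
  unfolding cov_mult[OF I_diff[OF assms] S_diff[OF assms]] I_parallel[OF assms] cov_S[OF assms]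
  by (simp add: matrix_ring_simps matrix_mul_assoc I_square[OF assms])

lemma mu_diff: "x \<in> U \<Longrightarrow> mu v differentiable (at x)"
  unfolding mu_def using Ck_on_1D[OF Ck_on_2D(2)[OF L_C2]] by auto

lemma nu_diff:
  assumes "x \<in> U" shows "nu v differentiable (at x)"
proof -
  have "Ck_on 1 U (\<lambda>y. \<chi> j. pd j L y)"
    by (rule Ck_on_vec[OF open_U]) (simp only: pd_def vec_lambda_beta Ck_on_2D(2)[OF L_C2])
  then have "Ck_on 1 U (\<lambda>y. ((I y *v v) \<bullet> (\<chi> j. pd j L y)) / 2)"
    by (intro Ck_on_linear[OF open_U bounded_linear_divide] Ck_on_bilinear[OF open_U bounded_bilinear_inner]
        Ck_on_linear[OF open_U bounded_linear_mult_vector] Ck_on_2D(3)[OF I_C2])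
  then have "Ck_on 1 U (nu v)"
    by (rule Ck_on_cong[OF open_U, rotated]) (simp add: nu_def fd_partials[OF L_diff])
  then show ?thesis using Ck_on_1D assms by blast
qed

lemma cov_cov_S:
  assumes "x \<in> U"
  shows "cov G (\<lambda>y. cov G S y v) x u = fd (mu v) x u *\<^sub>R S x + mu v x *\<^sub>R cov G S x u
    + (fd (nu v) x u *\<^sub>R (I x ** S x) + nu v x *\<^sub>R cov G (\<lambda>y. I y ** S y) x u)"
proof -
  have IS: "(\<lambda>y. I y ** S y) differentiable (at x)"
    by (rule differentiable_matrix_mult[OF I_diff[OF assms] S_diff[OF assms]])
  note d = fd_bilinear(2)[OF bounded_bilinear_scaleR mu_diff[OF assms, of v] S_diff[OF assms]]
    fd_bilinear(2)[OF bounded_bilinear_scaleR nu_diff[OF assms, of v] IS]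
  have "cov G (\<lambda>y. cov G S y v) x u = cov G (\<lambda>y. mu v y *\<^sub>R S y + nu v y *\<^sub>R (I y ** S y)) x u"
    by (rule cov_cong[symmetric, OF assms]) (use differentiable_add[OF d] cov_S in auto)
  then show ?thesis
    unfolding cov_add[OF d] cov_scaleR[OF mu_diff[OF assms, of v] S_diff[OF assms]] cov_scaleR[OF nu_diff[OF assms, of v] IS] .
qed

text \<open>Of the second covariant derivatives little survives antisymmetrisation:
  \<open>mu\<close> is half the differential of \<open>L\<close>, hence closed, and the products of
  \<open>mu\<close> and \<open>nu\<close> are symmetric in \<open>u\<close> and
  \<open>v\<close>.\<close>

lemma curv_S:
  assumes "x \<in> U"
  shows "curv G x u v ** S x - S x ** curv G x u v = (fd (nu v) x u - fd (nu u) x v) *\<^sub>R (I x ** S x)"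
proof -
  have "fd (mu v) x u = fd (mu u) x v" for u v
  proof -
    have "fd (mu v) x u = fd (\<lambda>y. fd L y v) x u / 2" for u v
      unfolding mu_def
      by (rule fd_bounded_linear[OF bounded_linear_divide Ck_on_1D[OF Ck_on_2D(2)[OF L_C2] assms]])
    then show ?thesis using second_derivative_symmetric[OF open_U L_C2 assms, of u v] by metis
  qed
  from this[of v u] show ?thesis
    unfolding ricci_identity[OF assms S_C2] cov_cov_S[OF assms] cov_IS[OF assms] cov_S[OF assms]
    by (simp add: algebra_simps)
qed

lemma ricci_log:
  assumes "x \<in> U"
  shows "(I x *v u) \<bullet> (ricci G x *v v) = - 1 / 2 * ext_d1 (\<lambda>y Z. fd L y (I y *v Z)) x u v"
proof -
  let ?R = "curv G x u v" and ?T = "I x ** S x"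
  define d where "d = fd (nu v) x u - fd (nu u) x v"
  interpret q: quaternionic_space "G x" "I x" "S x" "\<phi> x" by (rule quaternionic[OF assms])
  have ST: "S x ** ?T = \<phi> x *\<^sub>R I x" "?T ** S x = - \<phi> x *\<^sub>R I x" "?T ** ?T = - \<phi> x *\<^sub>R mat 1"
    unfolding matrix_eq
    by (simp_all add: matrix_vector_mul_assoc[symmetric] q.S_I q.S_S q.I_I vec.neg matrix_vector_mult_scaleR
      scaleR_matrix_vector_assoc[symmetric] matrix_vector_minus)
  have tr_scale: "trace (c *\<^sub>R M) = c * trace M" for c and M :: "real^4^4"
    by (simp add: trace_def sum_distrib_left)
  have "- (4 * d * \<phi> x) = trace ((?R ** S x - S x ** ?R) ** ?T)"
    \<comment> \<open>The 4 is the trace of the identity, and \<open>- \<phi> x\<close> comes from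
      \<open>?T ** ?T\<close>.\<close>
    unfolding curv_S[OF assms] d_def[symmetric] matrix_scaleR_left ST by (simp add: tr_scale trace_minus trace_I)
  also have "\<dots> = trace (?R ** (S x ** ?T)) - trace (?R ** (?T ** S x))"
    \<comment> \<open>Cyclicity shifts the commutator from \<open>?R\<close> and \<open>S x\<close>
      to \<open>S x\<close> and \<open>?T\<close>, whose two products are opposite multiples of
      \<open>I x\<close>.\<close>
    using trace_mul_sym[of "S x" "?R ** ?T"] by (simp add: matrix_sub_rdistrib trace_sub matrix_mul_assoc)
  also have "\<dots> = 2 * \<phi> x * trace (?R ** I x)"
    unfolding ST by (simp add: matrix_ring_simps tr_scale trace_minus)
  finally have "\<phi> x * (trace (?R ** I x) + 2 * d) = 0" by (simp add: algebra_simps)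
  then have "trace (?R ** I x) = - 2 * d"
    using \<phi>_pos[OF assms] by simp
  moreover have "d = ext_d1 (\<lambda>y Z. fd L y (I y *v Z)) x u v / 2"
  proof -
    have "fd (nu v) x u = fd (\<lambda>y. fd L y (I y *v v)) x u / 2" for u v
    proof -
      have "(\<lambda>y. 2 * nu v y) = (\<lambda>y. fd L y (I y *v v))" by (simp add: nu_def)
      then show ?thesis
        using fd_bounded_linear[OF bounded_linear_mult_right nu_diff[OF assms, of v], of 2 u] by simp
    qed
    then show ?thesis by (simp add: d_def ext_d1_def)
  qed
  ultimately show ?thesis unfolding ricci_form[OF assms] by simp
qed

lemma scalar_log: "x \<in> U \<Longrightarrow> scalar_curvature G x = laplacian G L x"
  by (rule scalar_curvature_laplacian[OF L_C2 _ ricci_log])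

end

section \<open>Skew endomorphisms with equal eigenvalues\<close>

lemma psd_kernel:
  fixes M :: "real^'n^'n"
  assumes sym: "\<And>u v. u \<bullet> (M *v v) = v \<bullet> (M *v u)" and psd: "\<And>v. v \<bullet> (M *v v) \<ge> 0"
    and u: "u \<bullet> (M *v u) = 0"
  shows "M *v u = 0"
proof -
  define w where "w = M *v u"
  define s where "s = w \<bullet> w"
  define k where "k = w \<bullet> (M *v w)"
  \<comment> \<open>With this step towards \<open>w\<close> the form at \<open>u + t w\<close>
    equals \<open>- s^2 (k + 2) / (k + 1)^2\<close>, which forces \<open>s = 0\<close>. The added 1
    keeps the denominator positive when \<open>k = 0\<close>.\<close>
  define t where "t = - s / (k + 1)"
  have k: "k \<ge> 0" unfolding k_def by (rule psd)
  have "(u + t *\<^sub>R w) \<bullet> (M *v (u + t *\<^sub>R w)) = 2 * t * s + t * t * k"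
    using sym[of u w] u
    by (simp add: matrix_vector_right_distrib matrix_vector_mult_scaleR inner_add_left inner_add_right
      algebra_simps w_def[symmetric] s_def k_def)
  then have "0 \<le> 2 * t * s + t * t * k" using psd by metis
  then have "0 \<le> (k + 1) * (k + 1) * (2 * t * s + t * t * k)" using k by simp
  also have "\<dots> = 2 * (k + 1) * ((k + 1) * t) * s + ((k + 1) * t) * ((k + 1) * t) * k"
    by (simp add: algebra_simps)
  also have "(k + 1) * t = - s" using k by (simp add: t_def)
  finally have "s * s * (k + 2) \<le> 0" by (simp add: algebra_simps)
  then have "s = 0" using k by (auto simp: mult_le_0_iff)
  then show ?thesis by (simp add: s_def w_def)
qed

text \<open>A maximum point of the Rayleigh quotient on the sphere.\<close>

lemma symmetric_max_eigenvector:
  fixes G T :: "real^'n^'n"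
  assumes G_sym: "\<And>u v. u \<bullet> (G *v v) = v \<bullet> (G *v u)" and G_pos: "\<And>u. u \<noteq> 0 \<Longrightarrow> u \<bullet> (G *v u) > 0"
    and T_sym: "\<And>u v. u \<bullet> (G *v (T *v v)) = v \<bullet> (G *v (T *v u))"
  obtains l u where "u \<noteq> 0" "T *v u = l *\<^sub>R u" "\<And>v. v \<bullet> (G *v (T *v v)) \<le> l * (v \<bullet> (G *v v))"
proof -
  define r where "r u = (u \<bullet> (G *v (T *v u))) / (u \<bullet> (G *v u))" for u
  have "continuous_on (sphere 0 1) r"
    unfolding r_def
  proof (intro continuous_on_divide continuous_on_inner continuous_on_id
      bounded_linear.continuous_on[OF matrix_vector_mul_bounded_linear] ballI)
    fix u :: "real^'n" assume "u \<in> sphere 0 1"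
    then have "u \<noteq> 0" by auto
    then show "u \<bullet> (G *v u) \<noteq> 0" using G_pos by force
  qed
  moreover have "sphere (0 :: real^'n) 1 \<noteq> {}" by simp
  ultimately obtain u where u: "norm u = 1" and max: "\<And>v. norm v = 1 \<Longrightarrow> r v \<le> r u"
    using continuous_attains_sup[OF compact_sphere] by (metis mem_sphere_0)
  have u0: "u \<noteq> 0" using u by auto
  \<comment> \<open>Maximality of \<open>r u\<close> makes \<open>M\<close> positive semidefinite
    with a zero of its form at \<open>u\<close>; \<open>psd_kernel\<close> turns this zero into the
    eigenvector equation.\<close>
  define M where "M = r u *\<^sub>R G - G ** T"
  have M: "v \<bullet> (M *v w) = r u * (v \<bullet> (G *v w)) - v \<bullet> (G *v (T *v w))" for v w
    by (simp add: M_def matrix_vector_mult_diff_rdistrib scaleR_matrix_vector_assoc[symmetric]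
      matrix_vector_mul_assoc inner_diff_right)
  have max': "v \<bullet> (G *v (T *v v)) \<le> r u * (v \<bullet> (G *v v))" for v
  proof (cases "v = 0")
    case False
    have "r (inverse (norm v) *\<^sub>R v) = r v"
      using False by (simp add: r_def matrix_vector_mult_scaleR)
    then have "r v \<le> r u" using max[of "inverse (norm v) *\<^sub>R v"] False by simp
    then show ?thesis using G_pos[OF False] by (simp add: r_def field_simps)
  qed simp
  have "M *v u = 0"
  proof (rule psd_kernel)
    show "u \<bullet> (M *v u) = 0" using G_pos[OF u0] by (simp add: M r_def)
    show "v \<bullet> (M *v v) \<ge> 0" for v using max' by (simp add: M)
    show "v \<bullet> (M *v w) = w \<bullet> (M *v v)" for v w unfolding M using G_sym[of v w] T_sym[of v w] by simp
  qed
  then have "v \<bullet> (G *v (r u *\<^sub>R u - T *v u)) = 0" for v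
    using M[of v u] by (simp add: matrix_vector_mult_diff_distrib matrix_vector_mult_scaleR inner_diff_right)
  then have "r u *\<^sub>R u - T *v u = 0" using G_pos by (metis less_irrefl)
  then show thesis using that[OF u0 _ max'] by simp
qed

text \<open>The eigenvector is \<open>S u + \<i> \<nu> u\<close>, unless this vanishes.\<close>

lemma skew_square_eigenvalue:
  fixes S :: "real^'n^'n"
  assumes "u \<noteq> 0" "S *v (S *v u) = - (\<nu>\<^sup>2) *\<^sub>R u"
  shows "complex_eigenvalue S (\<i> * complex_of_real \<nu>)"
proof (cases "\<nu> = 0 \<and> S *v u = 0")
  case True
  define v :: "complex^'n" where "v = (\<chi> i. complex_of_real (u $ i))"
  have "v \<noteq> 0" using assms(1) by (auto simp: v_def vec_eq_iff)
  moreover have "(\<chi> i j. complex_of_real (S $ i $ j)) *v v = 0"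
    using True by (simp add: v_def vec_eq_iff matrix_vector_mult_def flip: of_real_mult of_real_sum)
  ultimately show ?thesis unfolding complex_eigenvalue_def using True by (intro exI[of _ v]) simp
next
  case False
  define v :: "complex^'n" where "v = (\<chi> i. Complex ((S *v u) $ i) (\<nu> * u $ i))"
  have "v \<noteq> 0"
  proof
    assume "v = 0"
    then have "\<forall>i. (S *v u) $ i = 0 \<and> \<nu> * u $ i = 0" by (simp add: v_def vec_eq_iff complex_eq_iff)
    then have "S *v u = 0" "\<nu> *\<^sub>R u = 0" by (simp_all add: vec_eq_iff)
    then show False using False assms(1) by simp
  qed
  moreover have "(\<chi> i j. complex_of_real (S $ i $ j)) *v v = (\<i> * complex_of_real \<nu>) *s v"
  proof -
    have "(\<Sum>j\<in>UNIV. S $ i $ j * (S *v u) $ j) = - (\<nu> * (\<nu> * u $ i))" for i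
    proof -
      have "(S *v (S *v u)) $ i = (- (\<nu>\<^sup>2) *\<^sub>R u) $ i" using assms(2) by simp
      then show ?thesis by (simp add: matrix_vector_mult_def power2_eq_square)
    qed
    moreover have "(\<Sum>j\<in>UNIV. S $ i $ j * (\<nu> * u $ j)) = \<nu> * (S *v u) $ i" for i
      by (simp add: matrix_vector_mult_def sum_distrib_left mult.left_commute)
    ultimately show ?thesis
      by (simp add: vec_eq_iff complex_eq_iff v_def matrix_vector_mult_def[of "\<chi> i j. complex_of_real (S $ i $ j)"])
  qed
  ultimately show ?thesis unfolding complex_eigenvalue_def by blast
qed

text \<open>By the preceding lemma the extreme eigenvalues of the symmetric endomorphism \<open>S\<^sup>2\<close> are both \<open>- a\<^sup>2\<close>.\<close>

lemma skew_square:
  fixes G S :: "real^'n^'n"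
  assumes G_sym: "\<And>u v. u \<bullet> (G *v v) = v \<bullet> (G *v u)" and G_pos: "\<And>u. u \<noteq> 0 \<Longrightarrow> u \<bullet> (G *v u) > 0"
    and S_skew: "\<And>u v. (S *v u) \<bullet> (G *v v) = - (u \<bullet> (G *v (S *v v)))"
    and ev: "\<And>z. complex_eigenvalue S z \<Longrightarrow> z = \<i> * complex_of_real a \<or> z = - (\<i> * complex_of_real a)"
  shows "S ** S = - a\<^sup>2 *\<^sub>R mat 1"
proof -
  have sym: "u \<bullet> (G *v (S *v (S *v v))) = v \<bullet> (G *v (S *v (S *v u)))" for u v
    using S_skew[of u "S *v v"] S_skew[of v "S *v u"] G_sym[of "S *v u" "S *v v"] by linarith
  have lam: "l = - a\<^sup>2" if u: "u \<noteq> 0" and e: "S *v (S *v u) = l *\<^sub>R u" for u l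
  proof -
    have "l * (u \<bullet> (G *v u)) = - ((S *v u) \<bullet> (G *v (S *v u)))"
      using S_skew[of u "S *v u"] by (simp add: e matrix_vector_mult_scaleR)
    also have "\<dots> \<le> 0" using G_pos[of "S *v u"] by (cases "S *v u = 0") auto
    finally have "l \<le> 0" using G_pos[OF u] by (simp add: mult_le_0_iff)
    then have "complex_eigenvalue S (\<i> * complex_of_real (sqrt (- l)))"
      by (intro skew_square_eigenvalue[OF u]) (simp add: e)
    then have "sqrt (- l) = a \<or> sqrt (- l) = - a"
      using ev by (fastforce simp: complex_eq_iff)
    then have "(sqrt (- l))\<^sup>2 = a\<^sup>2" by auto
    then show ?thesis using \<open>l \<le> 0\<close> by simp
  qed
  obtain l u where 1: "u \<noteq> 0" "(S ** S) *v u = l *\<^sub>R u" "\<And>v. v \<bullet> (G *v ((S ** S) *v v)) \<le> l * (v \<bullet> (G *v v))"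
  proof (rule symmetric_max_eigenvector[OF G_sym G_pos])
    show "u \<bullet> (G *v ((S ** S) *v v)) = v \<bullet> (G *v ((S ** S) *v u))" for u v
      using sym[of u v] by (simp add: matrix_vector_mul_assoc)
  qed auto
  have "l = - a\<^sup>2" using lam 1(1,2) by (simp add: matrix_vector_mul_assoc)
  obtain \<mu> w where 2: "w \<noteq> 0" "(- (S ** S)) *v w = \<mu> *\<^sub>R w" "\<And>v. v \<bullet> (G *v ((- (S ** S)) *v v)) \<le> \<mu> * (v \<bullet> (G *v v))"
  proof (rule symmetric_max_eigenvector[OF G_sym G_pos])
    show "u \<bullet> (G *v ((- (S ** S)) *v v)) = v \<bullet> (G *v ((- (S ** S)) *v u))" for u v
      using sym[of u v] by (simp add: matrix_vector_minus vec.neg matrix_vector_mul_assoc)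
  qed auto
  have "S *v (S *v w) = - \<mu> *\<^sub>R w"
    using arg_cong[OF 2(2), of uminus] by (simp add: matrix_vector_minus matrix_vector_mul_assoc)
  then have "\<mu> = a\<^sup>2" using lam[OF 2(1), of "- \<mu>"] by simp
  have q: "v \<bullet> (G *v (S *v (S *v v))) = - a\<^sup>2 * (v \<bullet> (G *v v))" for v
    using 1(3)[of v] 2(3)[of v] unfolding \<open>l = - a\<^sup>2\<close> \<open>\<mu> = a\<^sup>2\<close>
    by (simp add: matrix_vector_minus vec.neg matrix_vector_mul_assoc[symmetric])
  have M: "u \<bullet> ((G ** (S ** S + a\<^sup>2 *\<^sub>R mat 1)) *v v) = u \<bullet> (G *v (S *v (S *v v))) + a\<^sup>2 * (u \<bullet> (G *v v))" for u v
    by (simp add: matrix_vector_mul_assoc[symmetric] matrix_vector_mult_add_rdistrib scaleR_matrix_vector_assoc[symmetric]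
      matrix_vector_right_distrib matrix_vector_mult_scaleR inner_add_right)
  \<comment> \<open>A symmetric form that vanishes on the diagonal is semidefinite, so
    \<open>psd_kernel\<close> applies to every vector.\<close>
  have "(G ** (S ** S + a\<^sup>2 *\<^sub>R mat 1)) *v v = 0" for v
  proof (rule psd_kernel)
    show "u \<bullet> ((G ** (S ** S + a\<^sup>2 *\<^sub>R mat 1)) *v w) = w \<bullet> ((G ** (S ** S + a\<^sup>2 *\<^sub>R mat 1)) *v u)" for u w
      unfolding M using sym[of u w] G_sym[of u w] by simp
    show "v \<bullet> ((G ** (S ** S + a\<^sup>2 *\<^sub>R mat 1)) *v v) = 0" for v
      unfolding M q by simp
    then show "0 \<le> v \<bullet> ((G ** (S ** S + a\<^sup>2 *\<^sub>R mat 1)) *v v)" for v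
      by simp
  qed
  then have "G *v ((S ** S + a\<^sup>2 *\<^sub>R mat 1) *v v) = 0" for v by (simp add: matrix_vector_mul_assoc)
  then have "(S ** S + a\<^sup>2 *\<^sub>R mat 1) *v v = 0 *v v" for v
    using G_pos by (metis inner_zero_right less_irrefl matrix_vector_mult_0)
  then have "S ** S + a\<^sup>2 *\<^sub>R mat 1 = 0" by (simp add: matrix_eq)
  then show ?thesis by (simp add: eq_neg_iff_add_eq_0)
qed

section \<open>Charts and pullbacks\<close>

lemma coords_iff:
  assumes "smooth_manifold A" "c \<in> A"
  shows "y \<in> coords c S \<longleftrightarrow> y \<in> snd c ` fst c \<and> param c y \<in> S"
    and "y \<in> coords c S \<Longrightarrow> param c y \<in> fst c" and "y \<in> coords c S \<Longrightarrow> snd c (param c y) = y"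
    and "p \<in> fst c \<Longrightarrow> param c (snd c p) = p"
proof -
  have h: "homeomorphism (fst c) (snd c ` fst c) (snd c) (param c)"
    using assms by (auto simp: smooth_manifold_def)
  note h = homeomorphism_apply1[OF h] homeomorphism_apply2[OF h]
  show "y \<in> coords c S \<longleftrightarrow> y \<in> snd c ` fst c \<and> param c y \<in> S"
    using h by (auto simp: coords_def)
  show "y \<in> coords c S \<Longrightarrow> param c y \<in> fst c" "y \<in> coords c S \<Longrightarrow> snd c (param c y) = y"
    using h by (auto simp: coords_def)
  show "p \<in> fst c \<Longrightarrow> param c (snd c p) = p" using h by auto
qed

lemma open_coords:
  assumes "smooth_manifold A" "c \<in> A" "open S"
  shows "open (coords c S)"
proof -
  have h: "homeomorphism (fst c) (snd c ` fst c) (snd c) (param c)" and o: "open (snd c ` fst c)"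
    using assms by (auto simp: smooth_manifold_def)
  have "openin (top_of_set (snd c ` fst c)) (snd c ` (fst c \<inter> S))"
    by (rule homeomorphism_imp_open_map[OF h]) (use assms(3) in blast)
  then show ?thesis using o by (simp add: coords_def openin_open_eq)
qed

lemma coords_mono: "S \<subseteq> T \<Longrightarrow> coords c S \<subseteq> coords c T"
  by (auto simp: coords_def)

lemma smooth_onD: "smooth_on S f \<Longrightarrow> Ck_on k S f"
  by (simp add: smooth_on_def)

lemma smooth_on_differentiable: "smooth_on S f \<Longrightarrow> x \<in> S \<Longrightarrow> f differentiable (at x)"
  using smooth_onD[of S f "Suc 0"] by simp

lemma jacobian_vector:
  fixes f :: "real^'n \<Rightarrow> real^'m"
  shows "f differentiable (at x) \<Longrightarrow> jacobian f (at x) *v v = fd f x v"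
  using fd_unique[OF iffD1[OF jacobian_works]] by metis

lemma jacobian_compose:
  fixes f :: "real^'n \<Rightarrow> real^'m" and k :: "real^'m \<Rightarrow> real^'p"
  assumes "f differentiable (at x)" "k differentiable (at (f x))"
  shows "jacobian (\<lambda>y. k (f y)) (at x) = jacobian k (at (f x)) ** jacobian f (at x)"
proof -
  have "((\<lambda>y. k (f y)) has_derivative (\<lambda>v. fd k (f x) (fd f x v))) (at x)"
    by (rule has_derivative_compose) (use assms in \<open>simp_all add: frechet_derivative_works\<close>)
  then have "fd (\<lambda>y. k (f y)) x v = fd k (f x) (fd f x v)" "(\<lambda>y. k (f y)) differentiable (at x)" for v
    by (auto simp: fd_unique differentiable_def)
  then show ?thesis
    by (simp add: matrix_eq jacobian_vector assms matrix_vector_mul_assoc[symmetric])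
qed

text \<open>The transformation law of the Kaehler form is what permits a free choice of target chart
  when it is pulled back.\<close>

lemma bilinear_field_kaehler_form:
  assumes B: "smooth_manifold B" and h: "bilinear_field B UNIV h" and J: "endo_field B UNIV J"
  shows "bilinear_field B UNIV (kaehler_form h J)"
  unfolding bilinear_field_def
proof (intro conjI ballI)
  fix c assume c: "c \<in> B"
  have "Ck_on k (coords c UNIV) (h c)" "Ck_on k (coords c UNIV) (J c)" for k
    using h J c unfolding bilinear_field_def endo_field_def smooth_on_def by blast+
  then have "Ck_on k (coords c UNIV) (\<lambda>x. transpose (J c x) ** h c x)" for k
    by (intro Ck_on_bilinear[OF _ bounded_bilinear_matrix_mult] Ck_on_linear[OF _ bounded_linear_transpose]
        open_coords[OF B c]) auto
  then show "smooth_on (coords c UNIV) (kaehler_form h J c)"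
    unfolding smooth_on_def kaehler_form_def[abs_def] by blast
next
  fix c c' p assume c: "c \<in> B" "c' \<in> B" "p \<in> fst c \<inter> fst c' \<inter> UNIV"
  define D where "D = jacobian (snd c' \<circ> param c) (at (snd c p))"
  have 1: "h c (snd c p) = transpose D ** h c' (snd c' p) ** D"
    and 2: "D ** J c (snd c p) = J c' (snd c' p) ** D"
    using h[unfolded bilinear_field_def Let_def] J[unfolded endo_field_def Let_def] c unfolding D_def by blast+
  have "transpose (J c (snd c p)) ** transpose D = transpose D ** transpose (J c' (snd c' p))"
    using arg_cong[OF 2, of transpose] by (simp add: matrix_transpose_mul)
  then have "kaehler_form h J c (snd c p) = transpose D ** kaehler_form h J c' (snd c' p) ** D"
    unfolding kaehler_form_def 1 by (simp add: matrix_mul_assoc)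
  then show "let D = jacobian (snd c' \<circ> param c) (at (snd c p))
        in kaehler_form h J c (snd c p) = transpose D ** kaehler_form h J c' (snd c' p) ** D"
    by (simp add: D_def Let_def)
qed

lemma smooth_map_local:
  assumes "smooth_map A B F" "c \<in> A" "c' \<in> B"
  shows "smooth_on (coords c (F -` fst c')) (snd c' \<circ> F \<circ> param c)"
  using assms by (simp add: smooth_map_def)

text \<open>The chart selected by \<open>SOME\<close> may jump from point to point. The
  transformation law replaces it by a fixed chart \<open>d\<close>, and only then can the pullback
  be differentiated.\<close>

lemma pullback_local:
  fixes A :: "('m::{t2_space,second_countable_topology}, 'n::finite) atlas"
    and B :: "('k::{t2_space,second_countable_topology}, 'p::finite) atlas"
  assumes A: "smooth_manifold A" and B: "smooth_manifold B" and F: "smooth_map A B F"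
    and T: "bilinear_field B UNIV T" and c: "c \<in> A" and d: "d \<in> B" and y: "y \<in> coords c (F -` fst d)"
  defines "f \<equiv> snd d \<circ> F \<circ> param c"
  shows "pullback B F T c y = transpose (jacobian f (at y)) ** T d (f y) ** jacobian f (at y)"
proof -
  define d' where "d' = (SOME c'. c' \<in> B \<and> F (param c y) \<in> fst c')"
  have yd: "F (param c y) \<in> fst d" using y coords_iff[OF A c] by auto
  have d': "d' \<in> B \<and> F (param c y) \<in> fst d'"
    unfolding d'_def by (rule someI[of _ d]) (use d yd in auto)
  define f' where "f' = snd d' \<circ> F \<circ> param c"
  define t where "t = snd d' \<circ> param d"
  define E where "E = jacobian t (at (f y))"
  define D where "D = jacobian f (at y)"
  have Fo: "open (F -` S)" if "open S" for S
    using F that continuous_on_open_vimage[of UNIV F] by (auto simp: smooth_map_def)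
  \<comment> \<open>On this open set the coordinate expressions of \<open>F\<close> differ by the
    transition map \<open>t\<close>; openness lets the identity pass to Jacobians.\<close>
  define W where "W = coords c (F -` (fst d \<inter> fst d'))"
  have W: "open W"
    unfolding W_def using B d d' by (intro open_coords[OF A c] Fo) (auto simp: smooth_manifold_def)
  have yW: "y \<in> W" using y yd d' coords_iff[OF A c] by (auto simp: W_def)
  have f: "f differentiable (at y)"
    unfolding f_def by (rule smooth_on_differentiable[OF smooth_map_local[OF F c d] y])
  have "f y = snd d (F (param c y))" by (simp add: f_def)
  then have fy: "f y \<in> coords d (fst d')" using yd d' by (auto simp: coords_def)
  have t: "t differentiable (at (f y))"
    unfolding t_def
    by (rule smooth_on_differentiable[OF _ fy]) (use B d d' in \<open>auto simp: smooth_manifold_def\<close>)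
  have tf: "t (f z) = f' z" if "z \<in> W" for z
  proof -
    have "F (param c z) \<in> fst d" using that coords_iff[OF A c] by (auto simp: W_def)
    then show ?thesis using coords_iff(4)[OF B d] by (simp add: t_def f_def f'_def)
  qed
  have "(\<lambda>z. t (f z)) differentiable (at y)"
    using differentiable_chain_at[OF f t] by (simp add: o_def)
  then have "fd (\<lambda>z. t (f z)) y = fd f' y"
    by (rule fd_transfer[OF W yW]) (rule tf)
  then have J: "jacobian f' (at y) = E ** D"
    using jacobian_compose[OF f t] by (simp add: jacobian_def E_def D_def)
  have "T d (snd d (F (param c y))) = transpose E ** T d' (snd d' (F (param c y))) ** E"
    using T[unfolded bilinear_field_def Let_def] d d' yd unfolding E_def t_def \<open>f y = snd d (F (param c y))\<close> by blast
  then have "transpose D ** T d (f y) ** D = transpose (E ** D) ** T d' (snd d' (F (param c y))) ** (E ** D)"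
    by (simp add: f_def matrix_transpose_mul matrix_mul_assoc)
  then show ?thesis
    unfolding pullback_def Let_def d'_def[symmetric] f'_def[symmetric] J D_def[symmetric] by simp
qed

section \<open>Parallel structures, closed forms and their pullbacks\<close>

lemma nabla_endo_cov:
  assumes "T differentiable (at x)"
  shows "cov G T x (axis i 1) $ k $ j = nabla_endo G T x i k j"
  by (simp add: cov_def nabla_endo_def pd_nth[OF assms] gam_axis matrix_matrix_mult_def mult.commute)

context metric_chart
begin

lemma kaehler_chart_intro:
  assumes "Ck_on 2 U I"
    and "\<And>x. x \<in> U \<Longrightarrow> I x ** I x = - mat 1"
    and "\<And>x u v. x \<in> U \<Longrightarrow> (I x *v u) \<bullet> (G x *v (I x *v v)) = u \<bullet> (G x *v v)"
    and nab: "\<And>x i k j. x \<in> U \<Longrightarrow> nabla_endo G I x i k j = 0"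
  shows "kaehler_chart U G I"
proof
  fix x u assume x: "x \<in> U"
  have d: "I differentiable (at x)" using Ck_on_2D(1)[OF assms(1) x] .
  have "cov G I x (axis i 1) = 0" for i
    using nabla_endo_cov[OF d, of G] nab[OF x] by (simp add: vec_eq_iff)
  then show "cov G I x u = 0"
    by (subst linear_axis_expansion[OF linear_cov[OF d]]) simp
qed (use assms in auto)

end

text \<open>For a parallel structure the right-hand side of \<open>cyclic_fd_lower\<close> vanishes.
  This is applied to the ambient manifold.\<close>

lemma (in kaehler_chart) kaehler_form_closed:
  assumes "x \<in> U"
  defines "W \<equiv> \<lambda>y. transpose (I y) ** G y"
  shows "u \<bullet> (W x *v v) = - (v \<bullet> (W x *v u))"
    and "W differentiable (at x)"
    and "v \<bullet> (fd W x u *v w) + w \<bullet> (fd W x v *v u) + u \<bullet> (fd W x w *v v) = 0"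
proof -
  have I: "I differentiable (at x)" using Ck_on_2D(1)[OF I_C2 assms(1)] .
  show skew: "u \<bullet> (W x *v v) = - (v \<bullet> (W x *v u))" for u v
    using I_skew[OF assms(1), of u v] G_sym[OF assms(1), of u "I x *v v"]
    by (simp add: W_def matrix_vector_mul_assoc[symmetric] inner_transpose del: transpose_matrix_vector)
  have "Ck_on 2 U W"
    unfolding W_def by (intro Ck_on_bilinear[OF _ bounded_bilinear_matrix_mult] Ck_on_linear[OF _ bounded_linear_transpose]
        open_U I_C2 G_C2)
  then show W: "W differentiable (at x)" using Ck_on_2D(1) assms(1) by blast
  show "v \<bullet> (fd W x u *v w) + w \<bullet> (fd W x v *v u) + u \<bullet> (fd W x w *v v) = 0"
    using cyclic_fd_lower[OF assms(1) I _ W skew, of v u w] I_parallel[OF assms(1)] by (simp add: W_def)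
qed

text \<open>Pullback commutes with the exterior derivative: the six terms with second derivatives of
  \<open>f\<close> cancel in three pairs, by their symmetry and the skewness of
  \<open>w\<close>.\<close>

lemma pullback_closed:
  fixes f :: "real^'n \<Rightarrow> real^'p" and w :: "real^'p \<Rightarrow> real^'p^'p"
  assumes U: "open U" and x: "x \<in> U" and f: "Ck_on 2 U f"
    and w: "w differentiable (at (f x))" "\<And>a b. a \<bullet> (w (f x) *v b) = - (b \<bullet> (w (f x) *v a))"
    and closed: "\<And>a b c. b \<bullet> (fd w (f x) a *v c) + c \<bullet> (fd w (f x) b *v a) + a \<bullet> (fd w (f x) c *v b) = 0"
    and W: "W differentiable (at x)" "\<And>y a b. y \<in> U \<Longrightarrow> a \<bullet> (W y *v b) = fd f y a \<bullet> (w (f y) *v fd f y b)"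
  shows "b \<bullet> (fd W x a *v c) + c \<bullet> (fd W x b *v a) + a \<bullet> (fd W x c *v b) = 0"
proof -
  have f': "f differentiable (at x)" "\<And>a. (\<lambda>y. fd f y a) differentiable (at x)"
    using Ck_on_2D(1)[OF f x] Ck_on_1D[OF Ck_on_2D(2)[OF f] x] by auto
  have wf: "((\<lambda>y. w (f y)) has_derivative (\<lambda>v. fd w (f x) (fd f x v))) (at x)"
    by (rule has_derivative_compose) (use f' w in \<open>simp_all add: frechet_derivative_works\<close>)
  then have wf': "(\<lambda>y. w (f y)) differentiable (at x)" by (auto simp: differentiable_def)
  define H where "H a b = fd (\<lambda>y. fd f y b) x a" for a b
  have H: "H a b = H b a" for a b
    unfolding H_def by (rule second_derivative_symmetric[OF U f x])
  have "b \<bullet> (fd W x a *v c) = H a b \<bullet> (w (f x) *v fd f x c)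
      + fd f x b \<bullet> (fd w (f x) (fd f x a) *v fd f x c) + fd f x b \<bullet> (w (f x) *v H a c)" for a b c
  proof -
    have d1: "(\<lambda>y. w (f y) *v fd f y c) differentiable (at x)"
      by (rule fd_bilinear(2)[OF bounded_bilinear_mult_vector wf' f'(2)])
    have d2: "(\<lambda>y. fd f y b \<bullet> (w (f y) *v fd f y c)) differentiable (at x)"
      by (rule fd_bilinear(2)[OF bounded_bilinear_inner f'(2) d1])
    have "b \<bullet> (fd W x a *v c) = fd (\<lambda>y. b \<bullet> (W y *v c)) x a"
      by (rule fd_bounded_linear[OF bounded_linear_form W(1), symmetric])
    also have "fd (\<lambda>y. b \<bullet> (W y *v c)) x = fd (\<lambda>y. fd f y b \<bullet> (w (f y) *v fd f y c)) x"
      by (rule fd_transfer[OF U x d2, symmetric]) (simp add: W(2))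
    also have "\<dots> a = fd f x b \<bullet> (w (f x) *v H a c + fd w (f x) (fd f x a) *v fd f x c)
        + H a b \<bullet> (w (f x) *v fd f x c)"
      unfolding fd_bilinear(1)[OF bounded_bilinear_inner f'(2) d1]
        fd_bilinear(1)[OF bounded_bilinear_mult_vector wf' f'(2)] fd_unique[OF wf] H_def ..
    finally show ?thesis by (simp add: inner_add_right)
  qed
  then show ?thesis
    using closed[of "fd f x b" "fd f x a" "fd f x c"] w(2)[of "H a b" "fd f x c"] w(2)[of "H b c" "fd f x a"]
      w(2)[of "H a c" "fd f x b"] H[of b a] H[of c a] H[of c b] by simp
qed

text \<open>Nondegeneracy settles the \<open>THE\<close> in \<open>sharp\<close>; the explicit
  formula is what later shows \<open>S\<close> to be of class two.\<close>

lemma sharp_eq: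
  fixes g W :: "('m, 'n::finite) field2"
  assumes sym: "\<And>u v. u \<bullet> (g c x *v v) = v \<bullet> (g c x *v u)"
    and pos: "\<And>u. u \<noteq> 0 \<Longrightarrow> u \<bullet> (g c x *v u) > 0"
  shows "sharp g W c x = matrix_inv (g c x) ** transpose (W c x)"
    and "(sharp g W c x *v u) \<bullet> (g c x *v v) = u \<bullet> (W c x *v v)"
proof -
  let ?G = "g c x" and ?S = "matrix_inv (g c x) ** transpose (W c x)"
  have "inj ((*v) ?G)"
  proof (rule injI, rule ccontr)
    fix a b assume "?G *v a = ?G *v b" "a \<noteq> b"
    then show False using pos[of "a - b"] by (simp add: matrix_vector_mult_diff_distrib)
  qed
  then have inv: "invertible ?G"
    unfolding invertible_left_inverse matrix_left_invertible_injective .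
  have ex: "(?S *v u) \<bullet> (?G *v v) = u \<bullet> (W c x *v v)" for u v
  proof -
    have "(?S *v u) \<bullet> (?G *v v) = v \<bullet> ((?G ** ?S) *v u)"
      by (simp add: sym[of "?S *v u" v] matrix_vector_mul_assoc)
    also have "?G ** ?S = transpose (W c x)"
      by (simp add: matrix_mul_assoc matrix_inv_mult(1)[OF inv])
    finally show ?thesis by (simp add: inner_transpose inner_commute del: transpose_matrix_vector)
  qed
  have "T = ?S" if "\<forall>u v. (T *v u) \<bullet> (?G *v v) = u \<bullet> (W c x *v v)" for T
  proof -
    have "T *v u = ?S *v u" for u
    proof (rule ccontr)
      assume "T *v u \<noteq> ?S *v u"
      then have "(T *v u - ?S *v u) \<bullet> (?G *v (T *v u - ?S *v u)) > 0" using pos by simp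
      then show False using that ex[of u] by (simp add: inner_diff_left)
    qed
    then show ?thesis by (simp add: matrix_eq)
  qed
  then show eq: "sharp g W c x = ?S"
    unfolding sharp_def using ex by (intro the_equality) blast+
  show "(sharp g W c x *v u) \<bullet> (g c x *v v) = u \<bullet> (W c x *v v)"
    unfolding eq by (rule ex)
qed

lemma bilinear_field_Ck_on: "bilinear_field B S T \<Longrightarrow> d \<in> B \<Longrightarrow> Ck_on k (coords d S) (T d)"
  unfolding bilinear_field_def smooth_on_def by blast

lemma endo_field_Ck_on: "endo_field B S T \<Longrightarrow> d \<in> B \<Longrightarrow> Ck_on k (coords d S) (T d)"
  unfolding endo_field_def smooth_on_def by blast

lemma Ck_on_jacobian:
  fixes f :: "real^'n \<Rightarrow> real^'m"
  assumes "open S" "Ck_on (Suc k) S f"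
  shows "Ck_on k S (\<lambda>x. jacobian f (at x))"
proof (intro Ck_on_vec assms(1))
  fix i j
  have "Ck_on k S (\<lambda>x. fd f x (axis j 1) $ i)"
    by (rule Ck_on_nth[OF assms(1)]) (use assms(2) in simp)
  then show "Ck_on k S (\<lambda>x. jacobian f (at x) $ i $ j)"
    by (simp add: jacobian_def matrix_def)
qed

theorem theorem3p1:
  fixes A :: "('m::{t2_space,second_countable_topology}, 4) atlas"
    and B :: "('k::{t2_space,second_countable_topology}, 8) atlas"
    and h J :: "('k, 8) field2"
    and F :: "'m \<Rightarrow> 'k"
    and \<theta> :: "'m \<Rightarrow> real"
    and \<Omega> :: "'m set"
    and g I :: "('m, 4) field2"
    and L :: "('m, 4) chart \<Rightarrow> real ^ 4 \<Rightarrow> real"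
  assumes "smooth_manifold A" and "smooth_manifold B"
    and "kaehler_einstein B h J" and "ricci_flat B h"
    and "smooth_immersion A B F"
    and g: "g = pullback B F h"
    and "equal_kaehler_angles A B h J F \<theta>"
    and "open \<Omega>" and "\<forall>p\<in>\<Omega>. cos (\<theta> p) \<noteq> 0"
    and "I_kaehler_on A B h J F \<theta> \<Omega> I"
    and L: "\<And>c x. L c x = ln ((cos (\<theta> (param c x)))\<^sup>2)"
  shows "\<forall>c\<in>A. \<forall>x\<in>coords c \<Omega>.
      (\<forall>X Y. (I c x *v X) \<bullet> (ricci (g c) x *v Y) =
         - 1 / 2 * ext_d1 (\<lambda>y Z. frechet_derivative (L c) (at y) (I c y *v Z)) x X Y) \<and>
      scalar_curvature (g c) x = laplacian (g c) (L c) x"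
proof (intro ballI)
  fix c x assume c: "c \<in> A" and x: "x \<in> coords c \<Omega>"
  note A = \<open>smooth_manifold A\<close> and B = \<open>smooth_manifold B\<close>
  have F: "smooth_map A B F" using \<open>smooth_immersion A B F\<close> by (simp add: smooth_immersion_def)
  have h: "bilinear_field B UNIV h" and J: "endo_field B UNIV J"
    using \<open>kaehler_einstein B h J\<close>
    unfolding kaehler_einstein_def riemannian_metric_def kaehler_on_def by blast+
  obtain d where d: "d \<in> B" "F (param c x) \<in> fst d"
  proof -
    have "F (param c x) \<in> (\<Union>d\<in>B. fst d)" using B unfolding smooth_manifold_def by blast
    then show thesis using that by blast
  qed
  have open_d: "open (fst d)" using B d unfolding smooth_manifold_def by blast
  define f where "f = snd d \<circ> F \<circ> param c"
  define D where "D y = jacobian f (at y)" for y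
  \<comment> \<open>The neighbourhood is shrunk until \<open>F\<close> maps it into the single
    target chart \<open>d\<close>; all derivatives are taken there.\<close>
  define U where "U = coords c (\<Omega> \<inter> F -` fst d)"
  define V where "V = coords d UNIV"
  define w where "w = kaehler_form h J d"
  define G where "G = g c"
  define W where "W = pullback B F (kaehler_form h J) c"
  define S where "S = pullback_omega_sharp B h J F c"
  define \<phi> where "\<phi> y = (cos (\<theta> (param c y)))\<^sup>2" for y
  have openF: "open (F -` T)" if "open T" for T
  proof -
    have "continuous_on UNIV F" using F unfolding smooth_map_def by blast
    then show ?thesis using that continuous_on_open_vimage[of UNIV F] by simp
  qed
  have U: "open U" unfolding U_def
    by (intro open_coords[OF A c] open_Int openF open_d \<open>open \<Omega>\<close>)
  have V: "open V" unfolding V_def by (rule open_coords[OF B d(1)]) simp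
  have xU: "x \<in> U" using x d unfolding U_def coords_iff(1)[OF A c] by blast
  have U_\<Omega>: "U \<subseteq> coords c \<Omega>" and U_F: "U \<subseteq> coords c (F -` fst d)"
    unfolding U_def by (auto intro!: coords_mono)
  have U_param: "param c y \<in> \<Omega>" "param c y \<in> fst c" "snd c (param c y) = y" if "y \<in> U" for y
  proof -
    have "y \<in> coords c \<Omega>" using that U_\<Omega> by blast
    then show "param c y \<in> \<Omega>" "param c y \<in> fst c" "snd c (param c y) = y"
      using coords_iff(1-3)[OF A c] by blast+
  qed
  have f: "Ck_on k U f" for k
    using smooth_onD[OF smooth_map_local[OF F c d(1)]] U_F unfolding f_def by (rule Ck_on_subset)
  have f_diff: "f differentiable (at y)" if "y \<in> U" for y
    using f[of "Suc 0"] that by simp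
  have fV: "f ` U \<subseteq> V"
  proof
    fix z assume "z \<in> f ` U"
    then obtain y where y: "y \<in> U" "z = f y" by blast
    then have "F (param c y) \<in> fst d" unfolding U_def coords_iff(1)[OF A c] by blast
    then show "z \<in> V" unfolding V_def coords_def y(2) f_def by simp
  qed
  \<comment> \<open>The Jacobian costs one order, so class two for the induced metric takes class
    three for \<open>f\<close>.\<close>
  have D: "Ck_on 2 U D"
    unfolding D_def[abs_def] by (rule Ck_on_jacobian[OF U f])
  have pull: "pullback B F T c y = transpose (D y) ** T d (f y) ** D y"
    if "bilinear_field B UNIV T" "y \<in> U" for T y
    unfolding D_def f_def by (rule pullback_local[OF A B F that(1) c d(1)]) (use that U_F in auto)
  have pull_form: "u \<bullet> (pullback B F T c y *v v) = fd f y u \<bullet> (T d (f y) *v fd f y v)"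
    if "bilinear_field B UNIV T" "y \<in> U" for T y u v
    by (simp add: pull[OF that] matrix_vector_mul_assoc[symmetric] inner_transpose D_def
      jacobian_vector[OF f_diff[OF that(2)]] del: transpose_matrix_vector)
  have pull_C2: "Ck_on 2 U (pullback B F T c)" if T: "bilinear_field B UNIV T" for T
  proof -
    have "Ck_on 2 V (T d)"
      unfolding V_def by (rule bilinear_field_Ck_on[OF T d(1)])
    then have "Ck_on 2 U (\<lambda>y. transpose (D y) ** T d (f y) ** D y)"
      by (intro Ck_on_bilinear[OF U bounded_bilinear_matrix_mult] Ck_on_linear[OF U bounded_linear_transpose]
          D Ck_on_compose[OF U fV f])
    then show ?thesis
      by (rule Ck_on_cong[OF U, rotated]) (simp add: pull[OF T])
  qed

  have V_metric: "transpose (h d y) = h d y" "u \<noteq> 0 \<Longrightarrow> u \<bullet> (h d y *v u) > 0" if "y \<in> V" for y u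
    using \<open>kaehler_einstein B h J\<close> d that
    by (auto simp: kaehler_einstein_def riemannian_metric_def V_def)
  have "Ck_on 2 V (h d)" "Ck_on 2 V (J d)"
    unfolding V_def by (rule bilinear_field_Ck_on[OF h d(1)], rule endo_field_Ck_on[OF J d(1)])
  interpret N0: metric_chart V "h d"
    by unfold_locales (use V V_metric \<open>Ck_on 2 V (h d)\<close> in auto)
  interpret N: kaehler_chart V "h d" "J d"
    using \<open>kaehler_einstein B h J\<close> d
    by (intro N0.kaehler_chart_intro \<open>Ck_on 2 V (J d)\<close>)
      (auto simp: kaehler_einstein_def kaehler_on_def V_def)
  have w_eq: "w = (\<lambda>y. transpose (J d y) ** h d y)"
    by (simp add: w_def kaehler_form_def fun_eq_iff)

  note wfield = bilinear_field_kaehler_form[OF B h J]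
  have G_form: "u \<bullet> (G y *v v) = fd f y u \<bullet> (h d (f y) *v fd f y v)" if "y \<in> U" for y u v
    unfolding G_def g using pull_form[OF h that] .
  have W_form: "u \<bullet> (W y *v v) = fd f y u \<bullet> (w (f y) *v fd f y v)" if "y \<in> U" for y u v
    unfolding W_def w_def using pull_form[OF wfield that] .
  have G_C2: "Ck_on 2 U G" and W_C2: "Ck_on 2 U W"
    unfolding G_def g W_def by (rule pull_C2[OF h], rule pull_C2[OF wfield])
  have fyV: "f y \<in> V" if "y \<in> U" for y using fV that by auto
  interpret M0: metric_chart U G
  proof
    fix y assume y: "y \<in> U"
    have "transpose (pullback B F h c y) = pullback B F h c y"
      by (simp add: pull[OF h y] matrix_transpose_mul V_metric(1)[OF fyV[OF y]] matrix_mul_assoc)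
    then show "transpose (G y) = G y" by (simp add: G_def g)
    fix u :: "real^4" assume "u \<noteq> 0"
    have "y \<in> coords c (F -` fst d)" using y U_F by auto
    then have "inj ((*v) (D y))"
      using \<open>smooth_immersion A B F\<close> c d by (auto simp: smooth_immersion_def D_def f_def)
    then have "D y *v u \<noteq> D y *v 0" using \<open>u \<noteq> 0\<close> by (metis injD)
    then have "fd f y u \<noteq> 0"
      by (simp add: D_def jacobian_vector[OF f_diff[OF y]])
    then show "u \<bullet> (G y *v u) > 0"
      unfolding G_form[OF y] by (rule V_metric(2)[OF fyV[OF y]])
  qed (use U G_C2 in auto)

  have I: "kaehler_on A \<Omega> g I"
    and IJ: "\<forall>y\<in>coords c \<Omega>. I c y ** J_omega B h J F \<theta> c y = - (J_omega B h J F \<theta> c y ** I c y)"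
    using \<open>I_kaehler_on A B h J F \<theta> \<Omega> I\<close> c g by (auto simp: I_kaehler_on_def)
  have "Ck_on 2 (coords c \<Omega>) (I c)"
    using I by (intro endo_field_Ck_on[of A] c) (simp add: kaehler_on_def)
  then have "Ck_on 2 U (I c)" using U_\<Omega> by (rule Ck_on_subset)
  then interpret M: kaehler_chart U G "I c"
    using I c U_\<Omega> by (intro M0.kaehler_chart_intro) (auto simp: kaehler_on_def G_def)

  have sharp: "S y = matrix_inv (G y) ** transpose (W y)" "(S y *v u) \<bullet> (G y *v v) = u \<bullet> (W y *v v)"
    if "y \<in> U" for y u v
    unfolding S_def pullback_omega_sharp_def W_def G_def g
    by (rule sharp_eq; use M0.G_sym[OF that] M0.G_pos[OF that] in \<open>simp add: G_def g\<close>)+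
  have S_C2: "Ck_on 2 U S"
  proof -
    have "Ck_on 2 U (\<lambda>y. matrix_inv (G y) ** transpose (W y))"
      by (intro Ck_on_bilinear[OF U bounded_bilinear_matrix_mult] Ck_on_linear[OF U bounded_linear_transpose]
          M0.G_inv_C2 W_C2)
    then show ?thesis by (rule Ck_on_cong[OF U, rotated]) (simp add: sharp(1))
  qed
  have W_skew: "u \<bullet> (W y *v v) = - (v \<bullet> (W y *v u))" if "y \<in> U" for y u v
    unfolding W_form[OF that] w_eq by (rule N.kaehler_form_closed(1)[OF fyV[OF that]])
  have S_skew: "(S y *v u) \<bullet> (G y *v v) = - (u \<bullet> (G y *v (S y *v v)))" if "y \<in> U" for y u v
    using sharp(2)[OF that] W_skew[OF that, of u v] M0.G_sym[OF that, of u "S y *v v"]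
      inner_commute[of "S y *v v" "G y *v u"] by metis
  have SG: "transpose (S y) ** G y = W y" if "y \<in> U" for y
  proof -
    have "u \<bullet> ((transpose (S y) ** G y) *v v) = u \<bullet> (W y *v v)" for u v
      using sharp(2)[OF that, of u v]
      by (simp add: matrix_vector_mul_assoc[symmetric] inner_transpose del: transpose_matrix_vector)
    then show ?thesis unfolding matrix_eq by (metis vector_eq_ldot)
  qed
  have cos0: "cos (\<theta> (param c y)) \<noteq> 0" if "y \<in> U" for y
    using \<open>\<forall>p\<in>\<Omega>. cos (\<theta> p) \<noteq> 0\<close> U_param[OF that] by auto
  interpret K: kaehler_surface U G "I c" S \<phi>
  proof
    show "Ck_on 2 U S" by (rule S_C2)
    fix y assume y: "y \<in> U"
    show "(S y *v u) \<bullet> (G y *v v) = - (u \<bullet> (G y *v (S y *v v)))" for u v by (rule S_skew[OF y])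
    show "\<phi> y > 0" using cos0[OF y] by (simp add: \<phi>_def)
    \<comment> \<open>The anti-commutation is given for the normalised \<open>J_omega\<close>; at
      each point it differs from \<open>S\<close> by a scalar only.\<close>
    have S_J: "S y = cos (\<theta> (param c y)) *\<^sub>R J_omega B h J F \<theta> c y"
      using cos0[OF y] by (simp add: J_omega_def S_def)
    have "I c y ** J_omega B h J F \<theta> c y = - (J_omega B h J F \<theta> c y ** I c y)"
      using IJ y U_\<Omega> by blast
    then show "I c y ** S y = - (S y ** I c y)"
      unfolding S_J matrix_scaleR_left matrix_scaleR_right by simp
    have "z = \<i> * complex_of_real (cos (\<theta> (param c y))) \<or> z = - (\<i> * complex_of_real (cos (\<theta> (param c y))))"
      if "complex_eigenvalue (S y) z" for z
    proof -
      have "complex_eigenvalue (pullback_omega_sharp B h J F c (snd c (param c y))) z"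
        using that U_param(3)[OF y] by (simp add: S_def)
      then show ?thesis
        using \<open>equal_kaehler_angles A B h J F \<theta>\<close> c U_param(2)[OF y]
        unfolding equal_kaehler_angles_def by blast
    qed
    then show "S y ** S y = - \<phi> y *\<^sub>R mat 1"
      unfolding \<phi>_def by (intro skew_square[OF M0.G_sym[OF y] M0.G_pos[OF y] S_skew[OF y]])
    have W: "W differentiable (at y)" using Ck_on_2D(1)[OF W_C2 y] .
    have "fd (\<lambda>y. transpose (S y) ** G y) y = fd W y"
      by (rule fd_transfer[OF U y W, symmetric]) (simp add: SG)
    moreover have "v \<bullet> (fd W y u *v k) + k \<bullet> (fd W y v *v u) + u \<bullet> (fd W y k *v v) = 0" for u v k
      by (rule pullback_closed[OF U y f _ _ _ W W_form])
        \<comment> \<open>Closedness holds for the ambient Kaehler form and passes to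
          \<open>W\<close> through \<open>f\<close>.\<close>
        (unfold w_eq, (rule N.kaehler_form_closed[OF fyV[OF y]] | assumption)+)
    ultimately show "v \<bullet> (fd (\<lambda>y. transpose (S y) ** G y) y u *v k) + k \<bullet> (fd (\<lambda>y. transpose (S y) ** G y) y v *v u)
      + u \<bullet> (fd (\<lambda>y. transpose (S y) ** G y) y k *v v) = 0" for u v k by simp
  qed
  \<comment> \<open>An equality of total functions, also off \<open>U\<close>, so derivatives and
    Laplacians of the two agree without a locality argument.\<close>
  have L_eq: "L c = K.L" by (simp add: fun_eq_iff L K.L_def \<phi>_def)
  show "(\<forall>X Y. (I c x *v X) \<bullet> (ricci (g c) x *v Y) =
         - 1 / 2 * ext_d1 (\<lambda>y Z. frechet_derivative (L c) (at y) (I c y *v Z)) x X Y) \<and>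
      scalar_curvature (g c) x = laplacian (g c) (L c) x"
    unfolding L_eq G_def[symmetric] using K.ricci_log[OF xU] K.scalar_log[OF xU] by blast
qed

end
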